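(* Let $R$ be a Stanley-Reisner ring over a field that has prime characteristic and is $F$-finite. Let $Q$ be any prime ideal of $R$. Then $$C_R(Q)=\sum_{\substack{P\in\operatorname{Min}(R)\\ P\subseteq Q}}P .$$ In particular, the image of the Cartier core map $Q\mapsto C_R(Q)$ on prime ideals, i.e. the set of generic points of $F$-pure centers of $R$, is the set of sums of (nonempty sets of) minimal primes of $R$. Further, if $J$ is any ideal of $R$, then $$C_R(J)=\sum_{\substack{\mathcal Q\subseteq\operatorname{Min}(R)\\ \left(\bigcap_{P\in\mathcal Q}P\right)\subseteq J}}\left(\bigcap_{P\in\mathcal Q}P\right),$$ where the intersection over the empty set is $R$.
   Context: A Stanley-Reisner ring over a field $k$ is a ring $R=S/I$ with $S$ a polynomial ring over $k$ in finitely many variables and $I$ a square-free monomial ideal of $S$. $\operatorname{Min}(R)$ is the set of minimal primes of $R$. $F_*^eR$ denotes $R$ viewed as an $R$-module via the $e$-th iterate of Frobenius: $r\,F_*^es=F_*^e(r^{p^e}s)$; a ring (or field) is $F$-finite if $F_*R$ is a finitely generated $R$-module. The Cartier core of an ideal $J$ of $R$ is $C_R(J)=\{r\in R:\phi(F_*^er)\in J\text{ for all }e>0\text{ and all }\phi\in\operatorname{Hom}_R(F_*^eR,R)\}$. An ideal $J$ is uniformly $F$-compatible if $\phi(F_*^e(J))\subseteq J$ for all $e$ and all $\phi\in\operatorname{Hom}_R(F_*^eR,R)$; for a Frobenius split ring such as a Stanley-Reisner ring, the generic points of $F$-pure centers are exactly the prime uniformly $F$-compatible ideals. *)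

theory Defs
  imports
    "HOL-Library.Poly_Mapping"
    "HOL-Computational_Algebra.Primes"
    "HOL-Algebra.QuotRing"
    "Jordan_Normal_Form.VS_Connect"
begin

text \<open>
  Polynomials over a field type \<open>'k\<close> with indeterminates in \<open>'x\<close> are finitely supported
  functions from exponent vectors \<open>'x \<Rightarrow>\<^sub>0 nat\<close> to \<open>'k\<close>, with the convolution product of
  the library. The variables actually allowed are those in the set \<open>V\<close>, which may be
  empty.
\<close>

type_synonym ('x, 'k) mpoly = "('x \<Rightarrow>\<^sub>0 nat) \<Rightarrow>\<^sub>0 'k"

definition mpoly_ring :: "'x set \<Rightarrow> ('x, 'k::comm_ring_1) mpoly ring" where
  "mpoly_ring V = class_ring \<lparr>carrier := {f. \<forall>m \<in> Poly_Mapping.keys f. Poly_Mapping.keys m \<subseteq> V}\<rparr>"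

definition squarefree_monomials :: "'x set \<Rightarrow> ('x, 'k::comm_ring_1) mpoly set" where
  "squarefree_monomials V =
     {Poly_Mapping.single m 1 | m. Poly_Mapping.keys m \<subseteq> V \<and> (\<forall>x. Poly_Mapping.lookup m x \<le> 1)}"

text \<open>
  The zero ideal (no generators) and the unit ideal (generated by the monomial \<open>1\<close>) are
  included.
\<close>

definition squarefree_monomial_ideal :: "'x set \<Rightarrow> ('x, 'k::comm_ring_1) mpoly set \<Rightarrow> bool" where
  "squarefree_monomial_ideal V I \<longleftrightarrow>
     (\<exists>G \<subseteq> squarefree_monomials V. I = Idl\<^bsub>mpoly_ring V\<^esub> G)"

definition minimal_primes :: "('a, 'b) ring_scheme \<Rightarrow> 'a set set" where
  "minimal_primes R =
     {P. primeideal P R \<and> (\<forall>P'. primeideal P' R \<and> P' \<subseteq> P \<longrightarrow> P' = P)}"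

text \<open>
  The sum of a possibly infinite family of ideals, consisting of all finite sums of
  elements of members of the family; the empty sum is the zero ideal.
\<close>

definition ideal_sum :: "('a, 'b) ring_scheme \<Rightarrow> 'i set \<Rightarrow> ('i \<Rightarrow> 'a set) \<Rightarrow> 'a set" where
  "ideal_sum R T A =
     {\<Oplus>\<^bsub>R\<^esub>i\<in>F. g i | F g. finite F \<and> F \<subseteq> T \<and> g \<in> (\<Pi> i\<in>F. A i)}"

text \<open>
  In all of the following, \<open>p\<close> is meant to be the characteristic. The element
  \<open>F\<^sub>*\<^sup>e s\<close> of \<open>F\<^sub>*\<^sup>e R\<close> is identified with \<open>s\<close>.
\<close>

definition frob_pushforward :: "nat \<Rightarrow> nat \<Rightarrow> ('a, 'b) ring_scheme \<Rightarrow> ('a, 'a) module" where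
  "frob_pushforward p e R =
     \<lparr>carrier = carrier R, mult = mult R, one = one R, zero = zero R, add = add R,
      smult = (\<lambda>r s. (r [^]\<^bsub>R\<^esub> (p ^ e)) \<otimes>\<^bsub>R\<^esub> s)\<rparr>"

definition self_module :: "('a, 'b) ring_scheme \<Rightarrow> ('a, 'a) module" where
  "self_module R =
     \<lparr>carrier = carrier R, mult = mult R, one = one R, zero = zero R, add = add R,
      smult = mult R\<rparr>"

definition frob_hom :: "nat \<Rightarrow> nat \<Rightarrow> ('a, 'b) ring_scheme \<Rightarrow> ('a \<Rightarrow> 'a) set" where
  "frob_hom p e R = LinearCombinations.module_hom R (frob_pushforward p e R) (self_module R)"

definition F_finite :: "nat \<Rightarrow> ('a, 'b) ring_scheme \<Rightarrow> bool" where
  "F_finite p R \<longleftrightarrow>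
     (\<exists>A. finite A \<and> A \<subseteq> carrier (frob_pushforward p 1 R) \<and>
          LinearCombinations.module.span R (frob_pushforward p 1 R) A
            = carrier (frob_pushforward p 1 R))"

definition cartier_core :: "nat \<Rightarrow> ('a, 'b) ring_scheme \<Rightarrow> 'a set \<Rightarrow> 'a set" where
  "cartier_core p R J = {r \<in> carrier R. \<forall>e>0. \<forall>\<phi> \<in> frob_hom p e R. \<phi> r \<in> J}"

definition uniformly_F_compatible :: "nat \<Rightarrow> ('a, 'b) ring_scheme \<Rightarrow> 'a set \<Rightarrow> bool" where
  "uniformly_F_compatible p R J \<longleftrightarrow> (\<forall>e. \<forall>\<phi> \<in> frob_hom p e R. \<phi> ` J \<subseteq> J)"

text \<open>
  For Frobenius split rings, the generic points of the \<open>F\<close>-pure centers are exactly the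
  prime uniformly \<open>F\<close>-compatible ideals. Stanley-Reisner rings are Frobenius split, and
  this description is taken as the definition here.
\<close>

definition F_pure_center_points :: "nat \<Rightarrow> ('a, 'b) ring_scheme \<Rightarrow> 'a set set" where
  "F_pure_center_points p R = {Q. primeideal Q R \<and> uniformly_F_compatible p R Q}"

end

theory Submission
  imports Defs
begin

text \<open>
  Write \<open>R = S / I\<close> and let \<open>\<Delta>\<close> be the simplicial complex of all sets of variables whose
  product lies outside \<open>I\<close>. All ideals in the theorem that are built from minimal primes are
  spanned by monomials. The minimal primes are the ideals \<open>P\<^sub>F\<close> generated by the variables
  outside a facet \<open>F\<close>: if \<open>Q\<close> is any prime and \<open>A\<close> is the set of variables that do not lie
  in \<open>Q\<close>, then \<open>A\<close> is a face, and \<open>P\<^sub>F \<subseteq> Q\<close> holds exactly when \<open>A \<subseteq> F\<close>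
  (\<open>face_prime_subset_prime_iff\<close>).

  That intersections of minimal primes contained in \<open>J\<close> lie in \<open>C(J)\<close> holds because every
  \<open>\<phi> : F\<^sub>*\<^sup>e R \<rightarrow> R\<close> maps \<open>P\<^sub>F\<close> to itself: the product of the variables in \<open>F\<close> is an element
  outside \<open>P\<^sub>F\<close> that annihilates \<open>P\<^sub>F\<close>
  (\<open>uniformly_F_compatible_minimal_prime\<close>).

  The reverse inclusion needs sufficiently many \<open>\<phi>\<close>, and they can be written down. For
  exponent vectors \<open>m\<close> and \<open>n\<close> and \<open>q = p\<^sup>e\<close> larger than all entries of \<open>m\<close>, the map
  \<open>c x\<^sup>k \<mapsto> l(c) x\<^sup>n x\<^bsup>(k - m)/q\<^esup>\<close> (zero where the exponent \<open>(k - m)/q\<close> is not a vector of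
  natural numbers) is an \<open>S\<close>-linear map \<open>F\<^sub>*\<^sup>e S \<rightarrow> S\<close>, where \<open>l\<close> is a \<open>q\<close>-inverse-linear
  functional on the field. It descends to \<open>R\<close> as soon as every facet containing the support
  of \<open>n\<close> contains the support of \<open>m\<close> (\<open>exists_trace_frob_hom\<close>). When \<open>q\<close> also
  exceeds all exponents of a polynomial \<open>f\<close>, such a map reads off the single coefficient of
  \<open>f\<close> at \<open>m\<close> and sends \<open>f\<close> to a multiple of \<open>x\<^sup>n\<close>. So if \<open>f\<close> represents an element of
  \<open>C(J)\<close> and \<open>x\<^sup>m\<close> occurs in \<open>f\<close>, then \<open>x\<^sup>n \<in> J\<close> for all \<open>n\<close> of this kind, and these
  monomials span exactly the intersection of the minimal primes that contain \<open>x\<^sup>m\<close>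
  (\<open>cartier_core_monomial\<close>). Hence each term of \<open>f\<close> lies in an intersection of minimal
  primes that is contained in \<open>J\<close>, which is the formula for \<open>C(J)\<close>.

  For a prime \<open>Q\<close> an intersection of minimal primes lies in \<open>Q\<close> only if one of them does,
  which reduces the formula to the sum of the minimal primes below \<open>Q\<close>. Sums of minimal
  primes are again generated by variables, hence prime, and they are uniformly
  \<open>F\<close>-compatible; the description of the image of the Cartier core map follows.
\<close>

section \<open>Functionals over the Frobenius\<close>

text \<open>
  The field is a vector space over itself when scalars act through the \<open>e\<close>-th iterate of
  Frobenius. A functional from this space to the field with its ordinary action that takes the
  value \<open>1\<close> at \<open>c\<close> exists because the vector \<open>c\<close> extends to a basis.
\<close>

lemma frobenius_functional:
  fixes c :: "'k::field"
  assumes "prime CHAR('k)" and "q = CHAR('k) ^ e" and "c \<noteq> 0"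
  obtains l :: "'k \<Rightarrow> 'k"
    where "\<And>x y. l (x + y) = l x + l y" and "\<And>a x. l (a ^ q * x) = a * l x" and "l c = 1"
proof -
  interpret F: vector_space "\<lambda>a x::'k. a ^ q * x"
    by standard (simp_all add: freshmans_dream' [OF assms(1,2)] algebra_simps power_mult_distrib)
  interpret FK: vector_space_pair "\<lambda>a x::'k. a ^ q * x" "\<lambda>a x::'k. a * x"
    by standard (simp_all add: algebra_simps)
  have "F.independent {c}"
    using \<open>c \<noteq> 0\<close> by simp
  from FK.linear_independent_extend [OF this, of "\<lambda>_. 1"]
  obtain g where g: "Vector_Spaces.linear (\<lambda>a x. a ^ q * x) (*) g" and gc: "g c = 1"
    by auto
  interpret g: Vector_Spaces.linear "\<lambda>a x. a ^ q * x" "(*)" g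
    by (rule g)
  show thesis
    by (rule that [of g]) (simp_all add: g.add g.scale gc)
qed

section \<open>Exponent vectors\<close>

definition scale_exponent :: "nat \<Rightarrow> ('x \<Rightarrow>\<^sub>0 nat) \<Rightarrow> 'x \<Rightarrow>\<^sub>0 nat" where
  "scale_exponent q m = Poly_Mapping.map ((*) q) m"

lemma lookup_scale_exponent [simp]:
  "Poly_Mapping.lookup (scale_exponent q m) x = q * Poly_Mapping.lookup m x"
  by (simp add: scale_exponent_def Poly_Mapping.map.rep_eq when_def)

lemma scale_exponent_add: "scale_exponent q (m + n) = scale_exponent q m + scale_exponent q n"
  by (rule poly_mapping_eqI) (simp add: lookup_add algebra_simps)

lemma scale_exponent_cancel [simp]:
  "q > 0 \<Longrightarrow> scale_exponent q m = scale_exponent q n \<longleftrightarrow> m = n"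
  by (auto simp: poly_mapping_eq_iff fun_eq_iff)

lemma keys_scale_exponent [simp]:
  "q > 0 \<Longrightarrow> Poly_Mapping.keys (scale_exponent q m) = Poly_Mapping.keys m"
  by (auto simp: in_keys_iff)

lemma keys_exponent_add:
  fixes m n :: "'x \<Rightarrow>\<^sub>0 nat"
  shows "Poly_Mapping.keys (m + n) = Poly_Mapping.keys m \<union> Poly_Mapping.keys n"
  by (auto simp: in_keys_iff lookup_add)

lemma single_power:
  "Poly_Mapping.single m c ^ q = Poly_Mapping.single (scale_exponent q m) (c ^ q)"
  for m :: "'x \<Rightarrow>\<^sub>0 nat" and c :: "'k::comm_ring_1"
proof (induction q)
  case 0
  have "scale_exponent 0 m = 0"
    by (rule poly_mapping_eqI) simp
  then show ?case by simp
next
  case (Suc q)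
  have "m + scale_exponent q m = scale_exponent (Suc q) m"
    by (rule poly_mapping_eqI) (simp add: lookup_add)
  with Suc show ?case by (simp add: mult_single)
qed

text \<open>
  In place of a monomial order on exponent vectors, which would need a linear order on the
  variables: maximising one coordinate after the other singles out one element of each set, and
  any other way of reaching the sum of the two maxima fails at the first coordinate where it
  differs.
\<close>

lemma unique_sum_exponents:
  fixes A B :: "('x \<Rightarrow>\<^sub>0 nat) set"
  assumes "finite A" "A \<noteq> {}" "finite B" "B \<noteq> {}"
  shows "\<exists>a\<in>A. \<exists>b\<in>B. \<forall>a'\<in>A. \<forall>b'\<in>B. a' + b' = a + b \<longrightarrow> a' = a \<and> b' = b"
proof -
  define agree_off :: "'x set \<Rightarrow> ('x \<Rightarrow>\<^sub>0 nat) set \<Rightarrow> bool" where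
    "agree_off X C \<longleftrightarrow>
      (\<forall>c\<in>C. \<forall>d\<in>C. \<forall>x. x \<notin> X \<longrightarrow> Poly_Mapping.lookup c x = Poly_Mapping.lookup d x)" for X C
  have *: "\<exists>a\<in>A. \<exists>b\<in>B. \<forall>a'\<in>A. \<forall>b'\<in>B. a' + b' = a + b \<longrightarrow> a' = a \<and> b' = b"
    if "finite X" "finite A" "A \<noteq> {}" "finite B" "B \<noteq> {}" "agree_off X A" "agree_off X B"
    for X :: "'x set" and A B
    using that
  proof (induction X arbitrary: A B rule: finite_induct)
    case empty
    have eq: "c = d" if "agree_off {} C" "c \<in> C" "d \<in> C" for C c d
      using that unfolding agree_off_def by (intro poly_mapping_eqI) blast
    obtain a b where "a \<in> A" "b \<in> B"
      using empty(2,4) by blast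
    with eq [OF empty(5)] eq [OF empty(6)] show ?case
      by (intro bexI [of _ a] bexI [of _ b] ballI impI conjI)
  next
    case (insert x X)
    \<comment> \<open>Both sets shrink to the elements with the largest entry at \<open>x\<close>.\<close>
    define top where "top C = {c \<in> C. Poly_Mapping.lookup c x = Max ((\<lambda>c. Poly_Mapping.lookup c x) ` C)}"
      for C :: "('x \<Rightarrow>\<^sub>0 nat) set"
    have top: "finite (top C)" "top C \<noteq> {}" "agree_off X (top C)"
      and le: "\<And>c d. c \<in> C \<Longrightarrow> d \<in> top C \<Longrightarrow> Poly_Mapping.lookup c x \<le> Poly_Mapping.lookup d x"
      and mem: "\<And>c d. c \<in> C \<Longrightarrow> d \<in> top C \<Longrightarrow>
        Poly_Mapping.lookup c x = Poly_Mapping.lookup d x \<Longrightarrow> c \<in> top C"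
      if "finite C" "C \<noteq> {}" "agree_off (insert x X) C" for C
    proof -
      show "finite (top C)"
        using that by (simp add: top_def)
      have "Max ((\<lambda>c. Poly_Mapping.lookup c x) ` C) \<in> (\<lambda>c. Poly_Mapping.lookup c x) ` C"
        using that by (intro Max_in) auto
      then show "top C \<noteq> {}"
        by (auto simp: top_def)
      show "agree_off X (top C)"
        unfolding agree_off_def
      proof (intro ballI allI impI)
        fix c d y assume cd: "c \<in> top C" "d \<in> top C" and "y \<notin> X"
        show "Poly_Mapping.lookup c y = Poly_Mapping.lookup d y"
        proof (cases "y = x")
          case True
          with cd show ?thesis by (simp add: top_def)
        next
          case False
          with \<open>y \<notin> X\<close> have "y \<notin> insert x X" by simp
          moreover have "c \<in> C" "d \<in> C" using cd by (simp_all add: top_def)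
          ultimately show ?thesis
            using that(3) unfolding agree_off_def by blast
        qed
      qed
      show "\<And>c d. c \<in> C \<Longrightarrow> d \<in> top C \<Longrightarrow> Poly_Mapping.lookup c x \<le> Poly_Mapping.lookup d x"
        using that by (simp add: top_def)
      show "\<And>c d. c \<in> C \<Longrightarrow> d \<in> top C \<Longrightarrow>
        Poly_Mapping.lookup c x = Poly_Mapping.lookup d x \<Longrightarrow> c \<in> top C"
        by (simp add: top_def)
    qed
    note A = insert.prems(1,2,5) and B = insert.prems(3,4,6)
    from insert.IH [OF top(1,2)[OF A] top(1,2)[OF B] top(3)[OF A] top(3)[OF B]]
    obtain a b where ab: "a \<in> top A" "b \<in> top B"
      and uniq: "\<And>a' b'. a' \<in> top A \<Longrightarrow> b' \<in> top B \<Longrightarrow> a' + b' = a + b \<Longrightarrow> a' = a \<and> b' = b"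
      by (elim bexE) simp
    have "a' = a \<and> b' = b" if "a' \<in> A" "b' \<in> B" "a' + b' = a + b" for a' b'
    proof -
      have "Poly_Mapping.lookup a' x + Poly_Mapping.lookup b' x
          = Poly_Mapping.lookup a x + Poly_Mapping.lookup b x"
        using arg_cong [OF that(3), of "\<lambda>m. Poly_Mapping.lookup m x"] by (simp add: lookup_add)
      with le [OF A that(1) ab(1)] le [OF B that(2) ab(2)]
      have "a' \<in> top A" "b' \<in> top B"
        by (intro mem [OF A that(1) ab(1)] mem [OF B that(2) ab(2)]; linarith)+
      with that(3) show ?thesis by (intro uniq)
    qed
    with ab show ?case
      by (intro bexI [of _ a] bexI [of _ b] ballI impI) (simp_all add: top_def)
  qed
  let ?X = "\<Union> (Poly_Mapping.keys ` (A \<union> B))"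
  have "finite ?X"
    using assms by simp
  moreover have "agree_off ?X A" "agree_off ?X B"
    unfolding agree_off_def by (auto simp: in_keys_iff)
  ultimately show ?thesis
    using assms by (intro * [of ?X])
qed

section \<open>Trace maps on polynomials\<close>

lemma poly_mapping_additive_induct [case_names single add]:
  fixes f :: "'a \<Rightarrow>\<^sub>0 'b::comm_monoid_add"
  assumes "\<And>m c. P (Poly_Mapping.single m c)" and "\<And>f g. P f \<Longrightarrow> P g \<Longrightarrow> P (f + g)"
  shows "P f"
proof (induction f rule: update_induct)
  case const
  show ?case using assms(1) [of undefined 0] by simp
next
  case (update f a b)
  have "Poly_Mapping.update a b f = f + Poly_Mapping.single a b"
    using update(1) by (intro poly_mapping_eqI)
      (auto simp: lookup_update lookup_add lookup_single when_def not_in_keys_iff_lookup_eq_zero)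
  then show ?case using update assms by simp
qed

text \<open>
  The additive map sending \<open>c x\<^bsup>a + q n\<^esup>\<close> to \<open>l(c) x\<^sup>n\<close> and killing all monomials whose
  exponents are not of the form \<open>a + q n\<close>. For \<open>a = 0\<close> and \<open>l(1) = 1\<close> it splits the iterated
  Frobenius; over a perfect field, \<open>a = (q - 1, \<dots>, q - 1)\<close> and \<open>l\<close> the \<open>q\<close>-th root give the
  usual generator of \<open>Hom(F\<^sub>*\<^sup>e S, S)\<close>.
\<close>

definition monomial_trace :: "('k \<Rightarrow> 'k) \<Rightarrow> nat \<Rightarrow> ('x \<Rightarrow>\<^sub>0 nat) \<Rightarrow>
    ('x, 'k::comm_ring_1) mpoly \<Rightarrow> ('x, 'k) mpoly" where
  "monomial_trace l q a f =
     Abs_poly_mapping (\<lambda>n. l (Poly_Mapping.lookup f (a + scale_exponent q n)))"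

locale frobenius_trace =
  fixes l :: "'k::field \<Rightarrow> 'k" and q e :: nat
  assumes prime_char: "prime CHAR('k)"
    and q_def: "q = CHAR('k) ^ e"
    and l_add: "l (x + y) = l x + l y"
    and l_scale: "l (a ^ q * x) = a * l x"
begin

lemma q_pos: "q > 0"
  using prime_char by (simp add: q_def prime_gt_0_nat)

lemma l_0 [simp]: "l 0 = 0"
  using l_add [of 0 0] by (metis add_0 add_cancel_right_right)

lemma lookup_trace:
  "Poly_Mapping.lookup (monomial_trace l q a f) n =
     l (Poly_Mapping.lookup f (a + scale_exponent q n))"
proof -
  have "{n. l (Poly_Mapping.lookup f (a + scale_exponent q n)) \<noteq> 0}
      \<subseteq> (\<lambda>n. a + scale_exponent q n) -` Poly_Mapping.keys f"
    by (auto simp: in_keys_iff)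
  moreover have "finite ((\<lambda>n. a + scale_exponent q n) -` Poly_Mapping.keys f)"
    by (rule finite_vimageI) (auto simp: inj_on_def q_pos)
  ultimately have "finite {n. l (Poly_Mapping.lookup f (a + scale_exponent q n)) \<noteq> 0}"
    by (rule finite_subset)
  then show ?thesis
    by (simp add: monomial_trace_def)
qed

lemma trace_add: "monomial_trace l q a (f + g) = monomial_trace l q a f + monomial_trace l q a g"
  by (rule poly_mapping_eqI) (simp add: lookup_trace lookup_add l_add)

lemma trace_single:
  "monomial_trace l q a (Poly_Mapping.single (a + scale_exponent q n) c) =
     Poly_Mapping.single n (l c)"
  by (rule poly_mapping_eqI) (simp add: lookup_trace lookup_single when_def q_pos)

lemma trace_single_eq_0:
  "m \<notin> range (\<lambda>n. a + scale_exponent q n) \<Longrightarrow>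
     monomial_trace l q a (Poly_Mapping.single m c) = 0"
  by (rule poly_mapping_eqI) (auto simp: lookup_trace lookup_single when_def)

lemma power_q_add: "(f + g) ^ q = f ^ q + g ^ q" for f g :: "('x, 'k) mpoly"
proof -
  have "CHAR(('x, 'k) mpoly) = CHAR('k)"
  proof (rule CHAR_eqI)
    show "of_nat CHAR('k) = (0 :: ('x, 'k) mpoly)"
      by (rule poly_mapping_eqI) (simp add: lookup_of_nat)
    fix n assume "of_nat n = (0 :: ('x, 'k) mpoly)"
    then have "Poly_Mapping.lookup (of_nat n :: ('x, 'k) mpoly) 0 = 0"
      by simp
    then have "of_nat n = (0 :: 'k)"
      by (simp add: lookup_of_nat)
    then show "CHAR('k) dvd n"
      by (simp add: of_nat_eq_0_iff_char_dvd)
  qed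
  then show ?thesis
    using freshmans_dream' [of q e f g] prime_char q_def by simp
qed

text \<open>
  The bound on \<open>a\<close> is what makes the trace linear over \<open>q\<close>-th powers: multiplying by a
  \<open>q\<close>-th power of a monomial keeps exponents of the form \<open>a + q n\<close> in that form, but if an
  entry of \<open>a\<close> were at least \<open>q\<close>, it could also bring other exponents into that form.
\<close>

lemma trace_power_mult:
  fixes f g :: "('x, 'k) mpoly"
  assumes small: "\<And>x. Poly_Mapping.lookup a x < q"
  shows "monomial_trace l q a (g ^ q * f) = g * monomial_trace l q a f"
proof (induction g rule: poly_mapping_additive_induct)
  case (add g h)
  then show ?case by (simp add: power_q_add distrib_right trace_add)
next
  case (single m c)
  show ?case
  proof (induction f rule: poly_mapping_additive_induct)
    case (add f g)
    then show ?case by (simp add: distrib_left trace_add)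
  next
    case (single k d)
    show ?case
    proof (cases "k \<in> range (\<lambda>n. a + scale_exponent q n)")
      case True
      then obtain n where n: "k = a + scale_exponent q n" by auto
      have "scale_exponent q m + k = a + scale_exponent q (m + n)"
        by (simp add: n scale_exponent_add ac_simps)
      then show ?thesis
        by (simp add: single_power mult_single n trace_single l_scale)
    next
      case False
      have "scale_exponent q m + k \<notin> range (\<lambda>n. a + scale_exponent q n)"
      proof
        assume "scale_exponent q m + k \<in> range (\<lambda>n. a + scale_exponent q n)"
        then obtain d where d: "scale_exponent q m + k = a + scale_exponent q d" by auto
        have eq: "q * Poly_Mapping.lookup m x + Poly_Mapping.lookup k x
            = Poly_Mapping.lookup a x + q * Poly_Mapping.lookup d x" for x
          using arg_cong [OF d, of "\<lambda>m. Poly_Mapping.lookup m x"] by (simp add: lookup_add)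
        have le: "Poly_Mapping.lookup m x \<le> Poly_Mapping.lookup d x" for x
        proof (rule ccontr)
          assume "\<not> ?thesis"
          then have "q * Suc (Poly_Mapping.lookup d x) \<le> q * Poly_Mapping.lookup m x"
            by (intro mult_le_mono) auto
          with eq [of x] small [of x] show False by simp
        qed
        have "k = a + scale_exponent q (d - m)"
        proof (rule poly_mapping_eqI)
          fix x
          have "q * Poly_Mapping.lookup d x =
              q * Poly_Mapping.lookup m x + q * (Poly_Mapping.lookup d x - Poly_Mapping.lookup m x)"
            using le [of x] by (simp flip: distrib_left)
          with eq [of x] show "Poly_Mapping.lookup k x =
              Poly_Mapping.lookup (a + scale_exponent q (d - m)) x"
            by (simp add: lookup_add lookup_minus)
        qed
        with False show False by auto
      qed
      with False show ?thesis
        by (simp add: single_power mult_single trace_single_eq_0)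
    qed
  qed
qed

text \<open>
  Once \<open>q\<close> exceeds every exponent occurring in \<open>f\<close>, at most one exponent of \<open>f\<close> is of the
  form \<open>m + q n\<close>, namely \<open>m\<close> itself.
\<close>

lemma trace_isolates:
  assumes "\<And>k x. k \<in> Poly_Mapping.keys f \<Longrightarrow> Poly_Mapping.lookup k x < q"
  shows "monomial_trace l q m f = Poly_Mapping.single 0 (l (Poly_Mapping.lookup f m))"
proof (rule poly_mapping_eqI)
  fix n
  have *: "m + scale_exponent q n \<notin> Poly_Mapping.keys f" if "n \<noteq> 0"
  proof
    assume mem: "m + scale_exponent q n \<in> Poly_Mapping.keys f"
    from that obtain x where "Poly_Mapping.lookup n x \<noteq> 0"
      by (metis poly_mapping_eqI lookup_zero)
    then have "q \<le> Poly_Mapping.lookup (m + scale_exponent q n) x"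
      by (simp add: lookup_add trans_le_add2)
    with assms [OF mem] show False
      by (metis not_le)
  qed
  have "scale_exponent q 0 = (0 :: 'a \<Rightarrow>\<^sub>0 nat)"
    by (rule poly_mapping_eqI) simp
  then show "Poly_Mapping.lookup (monomial_trace l q m f) n =
      Poly_Mapping.lookup (Poly_Mapping.single 0 (l (Poly_Mapping.lookup f m))) n"
    using * by (cases "n = 0")
      (auto simp: lookup_trace lookup_single not_in_keys_iff_lookup_eq_zero)
qed

end

section \<open>Monomial ideals of the polynomial ring\<close>

lemma mpoly_ring_simps [simp]:
  "mult (mpoly_ring V) = (*)" "add (mpoly_ring V) = (+)"
  "zero (mpoly_ring V) = 0" "one (mpoly_ring V) = 1"
  by (simp_all add: mpoly_ring_def)

lemma carrier_mpoly_ring: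
  "f \<in> carrier (mpoly_ring V) \<longleftrightarrow> (\<forall>m \<in> Poly_Mapping.keys f. Poly_Mapping.keys m \<subseteq> V)"
  by (simp add: mpoly_ring_def)

lemma single_in_mpoly_ring [simp]:
  "Poly_Mapping.keys m \<subseteq> V \<Longrightarrow> Poly_Mapping.single m c \<in> carrier (mpoly_ring V)"
  by (simp add: carrier_mpoly_ring)

lemma mpoly_ring_add_closed [simp]:
  "f \<in> carrier (mpoly_ring V) \<Longrightarrow> g \<in> carrier (mpoly_ring V) \<Longrightarrow> f + g \<in> carrier (mpoly_ring V)"
  using keys_add [of f g] by (auto simp: carrier_mpoly_ring)

lemma mpoly_ring_mult_closed [simp]:
  "f \<in> carrier (mpoly_ring V) \<Longrightarrow> g \<in> carrier (mpoly_ring V) \<Longrightarrow> f * g \<in> carrier (mpoly_ring V)"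
  using keys_mult [of f g] by (fastforce simp: carrier_mpoly_ring keys_exponent_add)

lemma keys_uminus_mpoly [simp]:
  "Poly_Mapping.keys (- f) = Poly_Mapping.keys f" for f :: "('x, 'k::comm_ring_1) mpoly"
  by (auto simp: in_keys_iff)

lemma cring_mpoly_ring: "cring (mpoly_ring V :: ('x, 'k::comm_ring_1) mpoly ring)"
proof (rule cringI)
  show "abelian_group (mpoly_ring V :: ('x, 'k) mpoly ring)"
  proof (rule abelian_groupI; simp add: ac_simps)
    fix f :: "('x, 'k) mpoly" assume "f \<in> carrier (mpoly_ring V)"
    then show "\<exists>g\<in>carrier (mpoly_ring V). f + g = 0"
      by (intro bexI [of _ "- f"]) (simp_all add: carrier_mpoly_ring)
  qed (simp add: carrier_mpoly_ring)
  show "comm_monoid (mpoly_ring V :: ('x, 'k) mpoly ring)"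
    by (rule comm_monoidI) (simp_all add: ac_simps, simp add: carrier_mpoly_ring)
qed (simp add: distrib_right)

lemma mpoly_ring_minus:
  assumes "f \<in> carrier (mpoly_ring V)" "g \<in> carrier (mpoly_ring V)"
  shows "f \<ominus>\<^bsub>mpoly_ring V\<^esub> g = f - g"
proof -
  interpret cring "mpoly_ring V :: ('a, 'b) mpoly ring"
    by (rule cring_mpoly_ring)
  have "- g \<in> carrier (mpoly_ring V)"
    using assms(2) by (simp add: carrier_mpoly_ring)
  then have "\<ominus>\<^bsub>mpoly_ring V\<^esub> g = - g"
    using assms(2) by (intro minus_equality) simp_all
  then show ?thesis
    by (simp add: a_minus_def)
qed

lemma mpoly_ring_pow: "f [^]\<^bsub>mpoly_ring V\<^esub> (n::nat) = f ^ n"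
  by (induction n) (simp_all add: ac_simps)

text \<open>
  Membership in an additive set may be checked term by term; this is how all inclusions between
  monomial ideals and arbitrary ideals are proved.
\<close>

lemma mpoly_in_additive_set:
  fixes f :: "'a \<Rightarrow>\<^sub>0 'b::comm_monoid_add"
  assumes "0 \<in> K" and "\<And>f g. f \<in> K \<Longrightarrow> g \<in> K \<Longrightarrow> f + g \<in> K"
    and "\<And>m. m \<in> Poly_Mapping.keys f \<Longrightarrow> Poly_Mapping.single m (Poly_Mapping.lookup f m) \<in> K"
  shows "f \<in> K"
proof -
  have "(\<Sum>m\<in>A. Poly_Mapping.single m (Poly_Mapping.lookup f m)) \<in> K"
    if "finite A" "A \<subseteq> Poly_Mapping.keys f" for A
    using that by (induction A rule: finite_induct) (auto intro: assms)
  moreover have "f = (\<Sum>m\<in>Poly_Mapping.keys f. Poly_Mapping.single m (Poly_Mapping.lookup f m))"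
    by (rule poly_mapping_eqI)
      (auto simp: lookup_sum lookup_single when_def sum.delta not_in_keys_iff_lookup_eq_zero)
  ultimately show ?thesis
    by (metis finite_keys order_refl)
qed

text \<open>
  Only the supports of monomials matter for the ideals of interest, so a squarefree monomial ideal
  is given by the family \<open>D\<close> of supports that it avoids. If \<open>D\<close> is closed under subsets, it is
  the simplicial complex whose Stanley--Reisner ideal this is; \<open>D = Pow F\<close> gives the ideal
  generated by the variables outside \<open>F\<close>.
\<close>

definition monomial_ideal :: "'x set \<Rightarrow> 'x set set \<Rightarrow> ('x, 'k::comm_ring_1) mpoly set" where
  "monomial_ideal V D =
     {f \<in> carrier (mpoly_ring V). \<forall>m \<in> Poly_Mapping.keys f. Poly_Mapping.keys m \<notin> D}"

lemma single_in_monomial_ideal [simp]: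
  "Poly_Mapping.keys m \<subseteq> V \<Longrightarrow> Poly_Mapping.keys m \<notin> D \<Longrightarrow>
     Poly_Mapping.single m c \<in> monomial_ideal V D"
  by (simp add: monomial_ideal_def)

lemma ideal_monomial_ideal:
  assumes down: "\<And>A B. A \<in> D \<Longrightarrow> B \<subseteq> A \<Longrightarrow> B \<in> D"
  shows "ideal (monomial_ideal V D :: ('x, 'k::comm_ring_1) mpoly set) (mpoly_ring V)"
proof -
  interpret cring "mpoly_ring V :: ('x, 'k) mpoly ring"
    by (rule cring_mpoly_ring)
  have mult: "g * f \<in> monomial_ideal V D"
    if "f \<in> monomial_ideal V D" "g \<in> carrier (mpoly_ring V)" for f g :: "('x, 'k) mpoly"
  proof -
    have "Poly_Mapping.keys m \<notin> D" if m: "m \<in> Poly_Mapping.keys (g * f)" for m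
    proof -
      obtain a b where ab: "m = a + b" "a \<in> Poly_Mapping.keys g" "b \<in> Poly_Mapping.keys f"
        using keys_mult [of g f] m by auto
      with \<open>f \<in> _\<close> have "Poly_Mapping.keys b \<notin> D"
        by (simp add: monomial_ideal_def)
      with down [of "Poly_Mapping.keys m" "Poly_Mapping.keys b"] show ?thesis
        by (auto simp: ab keys_exponent_add)
    qed
    with that show ?thesis
      by (simp add: monomial_ideal_def)
  qed
  show ?thesis
  proof (rule idealI)
    show "subgroup (monomial_ideal V D) (add_monoid (mpoly_ring V :: ('x, 'k) mpoly ring))"
    proof (rule add.subgroupI)
      fix f :: "('x, 'k) mpoly" assume f: "f \<in> monomial_ideal V D"
      then have "0 \<ominus>\<^bsub>mpoly_ring V\<^esub> f = - f"
        by (subst mpoly_ring_minus) (auto simp: monomial_ideal_def carrier_mpoly_ring)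
      then have "\<ominus>\<^bsub>mpoly_ring V\<^esub> f = - f"
        using f by (simp add: a_minus_def monomial_ideal_def)
      with f show "\<ominus>\<^bsub>mpoly_ring V\<^esub> f \<in> monomial_ideal V D"
        by (simp add: monomial_ideal_def carrier_mpoly_ring)
    next
      fix f g :: "('x, 'k) mpoly"
      assume "f \<in> monomial_ideal V D" "g \<in> monomial_ideal V D"
      then show "f \<oplus>\<^bsub>mpoly_ring V\<^esub> g \<in> monomial_ideal V D"
        using keys_add [of f g] by (auto simp: monomial_ideal_def)
    next
      have "0 \<in> (monomial_ideal V D :: ('x, 'k) mpoly set)"
        by (simp add: monomial_ideal_def carrier_mpoly_ring)
      then show "(monomial_ideal V D :: ('x, 'k) mpoly set) \<noteq> {}"
        by blast
    qed (auto simp: monomial_ideal_def)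
  next
    fix f g :: "('x, 'k) mpoly"
    assume fg: "f \<in> monomial_ideal V D" "g \<in> carrier (mpoly_ring V)"
    from mult [OF this] show "g \<otimes>\<^bsub>mpoly_ring V\<^esub> f \<in> monomial_ideal V D"
      by simp
    from mult [OF fg] show "f \<otimes>\<^bsub>mpoly_ring V\<^esub> g \<in> monomial_ideal V D"
      by (simp add: mult.commute)
  qed (rule ring_axioms)
qed

text \<open>
  If neither factor lies in the ideal, both have terms supported in \<open>F\<close>. Among these terms pick
  two whose exponents \<open>a\<close> and \<open>b\<close> have a sum that is reached in only one way. Exponents with
  sum \<open>a + b\<close> are automatically supported in \<open>F\<close>, so the coefficient of the product at
  \<open>a + b\<close> is the product of two nonzero coefficients.
\<close>

lemma primeideal_monomial_ideal:
  fixes V :: "'x set"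
  shows "primeideal (monomial_ideal V (Pow F) :: ('x, 'k::idom) mpoly set) (mpoly_ring V)"
proof (rule primeidealI)
  show "ideal (monomial_ideal V (Pow F) :: ('x, 'k) mpoly set) (mpoly_ring V)"
    by (rule ideal_monomial_ideal) auto
  have "1 \<in> carrier (mpoly_ring V)" "1 \<notin> (monomial_ideal V (Pow F) :: ('x, 'k) mpoly set)"
    by (simp_all add: monomial_ideal_def carrier_mpoly_ring)
  then show "carrier (mpoly_ring V) \<noteq> (monomial_ideal V (Pow F) :: ('x, 'k) mpoly set)"
    by blast
next
  fix f g :: "('x, 'k) mpoly"
  assume carr: "f \<in> carrier (mpoly_ring V)" "g \<in> carrier (mpoly_ring V)"
    and fg: "f \<otimes>\<^bsub>mpoly_ring V\<^esub> g \<in> monomial_ideal V (Pow F)"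
  let ?K = "\<lambda>f::('x, 'k) mpoly. {m \<in> Poly_Mapping.keys f. Poly_Mapping.keys m \<subseteq> F}"
  show "f \<in> monomial_ideal V (Pow F) \<or> g \<in> monomial_ideal V (Pow F)"
  proof (rule ccontr)
    assume "\<not> ?thesis"
    with carr have ne: "?K f \<noteq> {}" "?K g \<noteq> {}"
      by (auto simp: monomial_ideal_def)
    have fin: "finite (?K f)" "finite (?K g)"
      by simp_all
    obtain a b where ab: "a \<in> ?K f" "b \<in> ?K g"
      and uniq: "\<forall>a'\<in>?K f. \<forall>b'\<in>?K g. a' + b' = a + b \<longrightarrow> a' = a \<and> b' = b"
      using unique_sum_exponents [OF fin(1) ne(1) fin(2) ne(2)] by (elim bexE)
    have inner: "Poly_Mapping.lookup f l * (\<Sum>n. Poly_Mapping.lookup g n when a + b = l + n) =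
        (Poly_Mapping.lookup f a * Poly_Mapping.lookup g b when l = a)" for l
    proof (cases "l = a")
      case True
      then show ?thesis by simp
    next
      case False
      have "Poly_Mapping.lookup f l * (Poly_Mapping.lookup g n when a + b = l + n) = 0" for n
      proof (rule ccontr)
        assume "\<not> ?thesis"
        then have l: "l \<in> Poly_Mapping.keys f" and n: "n \<in> Poly_Mapping.keys g" and eq: "a + b = l + n"
          by (auto simp: in_keys_iff when_def split: if_splits)
        have "Poly_Mapping.keys l \<union> Poly_Mapping.keys n \<subseteq> F"
          using ab eq keys_exponent_add [of a b] keys_exponent_add [of l n] by auto
        with l n have "l \<in> ?K f" "n \<in> ?K g" by simp_all
        from bspec [OF bspec [OF uniq this(1)] this(2)] eq False show False by simp
      qed
      then have "Poly_Mapping.lookup f l = 0 \<or> (\<forall>n. (Poly_Mapping.lookup g n when a + b = l + n) = 0)"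
        by auto
      then show ?thesis
        using False by auto
    qed
    have "Poly_Mapping.lookup (f * g) (a + b) = Poly_Mapping.lookup f a * Poly_Mapping.lookup g b"
      unfolding lookup_mult inner by simp
    then have "a + b \<in> Poly_Mapping.keys (f * g)"
      using ab by (simp add: in_keys_iff)
    moreover have "Poly_Mapping.keys (a + b) \<subseteq> F"
      using ab by (simp add: keys_exponent_add)
    ultimately show False
      using fg by (simp add: monomial_ideal_def)
  qed
qed (rule cring_mpoly_ring)

text \<open>
  The faces are the sets of variables containing the support of no generator. Squarefreeness
  enters in that a generator whose support is contained in that of a monomial divides it.
\<close>

lemma squarefree_monomial_ideal_faces:
  fixes I :: "('x, 'k::comm_ring_1) mpoly set"
  assumes "squarefree_monomial_ideal V I"
  obtains D where "D \<subseteq> Pow V" "\<And>A B. A \<in> D \<Longrightarrow> B \<subseteq> A \<Longrightarrow> B \<in> D" "I = monomial_ideal V D"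
proof -
  interpret cring "mpoly_ring V :: ('x, 'k) mpoly ring"
    by (rule cring_mpoly_ring)
  from assms obtain G where G: "G \<subseteq> squarefree_monomials V" and I: "I = Idl\<^bsub>mpoly_ring V\<^esub> G"
    by (auto simp: squarefree_monomial_ideal_def)
  define D where "D = {A. A \<subseteq> V \<and> (\<forall>g. Poly_Mapping.single g 1 \<in> G \<longrightarrow> \<not> Poly_Mapping.keys g \<subseteq> A)}"
  have down: "A \<in> D \<Longrightarrow> B \<subseteq> A \<Longrightarrow> B \<in> D" for A B
    unfolding D_def by blast
  have Gcarr: "G \<subseteq> carrier (mpoly_ring V)"
    using G by (auto simp: squarefree_monomials_def)
  interpret Idl: ideal I "mpoly_ring V"
    unfolding I using Gcarr by (rule genideal_ideal)
  have "I = monomial_ideal V D"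
  proof
    show "I \<subseteq> monomial_ideal V D"
      unfolding I
    proof (rule genideal_minimal)
      show "ideal (monomial_ideal V D :: ('x, 'k) mpoly set) (mpoly_ring V)"
        using down by (rule ideal_monomial_ideal)
      show "G \<subseteq> monomial_ideal V D"
      proof
        fix f assume f: "f \<in> G"
        with G obtain m where m: "f = Poly_Mapping.single m 1" "Poly_Mapping.keys m \<subseteq> V"
          by (auto simp: squarefree_monomials_def)
        with f have "Poly_Mapping.keys m \<notin> D"
          unfolding D_def by blast
        with m show "f \<in> monomial_ideal V D"
          by simp
      qed
    qed
  next
    show "monomial_ideal V D \<subseteq> I"
    proof
      fix f :: "('x, 'k) mpoly"
      assume f: "f \<in> monomial_ideal V D"
      show "f \<in> I"
      proof (rule mpoly_in_additive_set)
        fix m assume "m \<in> Poly_Mapping.keys f"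
        with f have m: "Poly_Mapping.keys m \<subseteq> V" "Poly_Mapping.keys m \<notin> D"
          by (auto simp: monomial_ideal_def carrier_mpoly_ring)
        then obtain g where g: "Poly_Mapping.single g 1 \<in> G" "Poly_Mapping.keys g \<subseteq> Poly_Mapping.keys m"
          by (auto simp: D_def)
        from G g(1) obtain g' where g': "Poly_Mapping.single g 1 = Poly_Mapping.single g' (1 :: 'k)"
          "\<forall>x. Poly_Mapping.lookup g' x \<le> 1"
          unfolding squarefree_monomials_def by blast
        from arg_cong [OF g'(1), of Poly_Mapping.keys] have "g' = g"
          by simp
        with g'(2) have "Poly_Mapping.lookup g x \<le> 1" for x
          by simp
        with g(2) have le: "Poly_Mapping.lookup g x \<le> Poly_Mapping.lookup m x" for x
          by (metis in_keys_iff le_less_linear less_one order_trans subsetD zero_le)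
        have "m = (m - g) + g"
          using le by (intro poly_mapping_eqI) (simp add: lookup_add lookup_minus)
        then have eq: "Poly_Mapping.single m c = Poly_Mapping.single (m - g) c * Poly_Mapping.single g 1"
          for c :: 'k
          by (simp add: mult_single)
        have "Poly_Mapping.keys (m - g) \<subseteq> V"
          using m(1) by (auto simp: in_keys_iff lookup_minus subset_iff)
        moreover have "Poly_Mapping.single g 1 \<in> I"
          using g(1) genideal_self [OF Gcarr] by (auto simp: I)
        ultimately show "Poly_Mapping.single m (Poly_Mapping.lookup f m) \<in> I"
          unfolding eq using Idl.I_l_closed by fastforce
      qed (use Idl.a_closed Idl.zero_closed in auto)
    qed
  qed
  moreover have "D \<subseteq> Pow V"
    unfolding D_def by blast
  ultimately show thesis
    using down by (rule that [rotated 2])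
qed

section \<open>Sums of families of ideals\<close>

context ring
begin

lemma ideal_sum_incl:
  assumes "i \<in> T" "A i \<subseteq> carrier R"
  shows "A i \<subseteq> ideal_sum R T A"
proof
  fix a assume a: "a \<in> A i"
  then have "a = (\<Oplus>j\<in>{i}. a)"
    using assms by (simp add: subset_iff)
  with a assms(1) show "a \<in> ideal_sum R T A"
    unfolding ideal_sum_def by (intro CollectI exI [of _ "{i}"] exI [of _ "\<lambda>_. a"]) auto
qed

lemma ideal_sum_least:
  assumes "\<And>i. i \<in> T \<Longrightarrow> A i \<subseteq> K" and K: "K \<subseteq> carrier R" "\<zero> \<in> K"
    "\<And>a b. a \<in> K \<Longrightarrow> b \<in> K \<Longrightarrow> a \<oplus> b \<in> K"
  shows "ideal_sum R T A \<subseteq> K"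
proof -
  have "(\<Oplus>i\<in>F. g i) \<in> K" if "finite F" "F \<subseteq> T" "g \<in> (\<Pi> i\<in>F. A i)" for F g
    using that
  proof (induction F rule: finite_induct)
    case (insert i F)
    then have "g \<in> F \<rightarrow> carrier R" "g i \<in> K"
      using assms(1) K(1) by (auto simp: Pi_iff subset_iff)
    with insert K show ?case
      by (subst finsum_insert) auto
  qed (simp add: K)
  then show ?thesis
    by (auto simp: ideal_sum_def)
qed

lemma zero_in_ideal_sum: "\<zero> \<in> ideal_sum R T A"
  unfolding ideal_sum_def by (intro CollectI exI [of _ "{}"]) simp

lemma ideal_sum_add_closed:
  assumes A: "\<And>i. i \<in> T \<Longrightarrow> ideal (A i) R"
    and "a \<in> ideal_sum R T A" "b \<in> ideal_sum R T A"
  shows "a \<oplus> b \<in> ideal_sum R T A"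
proof -
  obtain F g where g: "finite F" "F \<subseteq> T" "g \<in> (\<Pi> i\<in>F. A i)" "a = (\<Oplus>i\<in>F. g i)"
    using assms(2) by (auto simp: ideal_sum_def)
  obtain G h where h: "finite G" "G \<subseteq> T" "h \<in> (\<Pi> i\<in>G. A i)" "b = (\<Oplus>i\<in>G. h i)"
    using assms(3) by (auto simp: ideal_sum_def)
  define g' where "g' i = (if i \<in> F then g i else \<zero>)" for i
  define h' where "h' i = (if i \<in> G then h i else \<zero>)" for i
  have mem: "g' i \<in> A i" "h' i \<in> A i" "A i \<subseteq> carrier R" if "i \<in> F \<union> G" for i
  proof -
    interpret ideal "A i" R
      using that g(2) h(2) by (intro A) auto
    show "g' i \<in> A i" "h' i \<in> A i" "A i \<subseteq> carrier R"
      using g(3) h(3) a_subset by (auto simp: g'_def h'_def)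
  qed
  have "a = (\<Oplus>i\<in>F \<union> G. g' i)"
    unfolding g(4) using g h mem
    by (intro add.finprod_mono_neutral_cong_left) (auto simp: g'_def Pi_iff subset_iff)
  moreover have "b = (\<Oplus>i\<in>F \<union> G. h' i)"
    unfolding h(4) using g h mem
    by (intro add.finprod_mono_neutral_cong_left) (auto simp: h'_def Pi_iff subset_iff)
  ultimately have "a \<oplus> b = (\<Oplus>i\<in>F \<union> G. g' i \<oplus> h' i)"
    using mem by (subst finsum_addf) (auto simp: Pi_iff subset_iff)
  moreover have "(\<lambda>i. g' i \<oplus> h' i) \<in> (\<Pi> i\<in>F \<union> G. A i)"
  proof
    fix i assume i: "i \<in> F \<union> G"
    interpret ideal "A i" R
      using i g(2) h(2) by (intro A) auto
    show "g' i \<oplus> h' i \<in> A i"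
      using mem [OF i] by simp
  qed
  ultimately show ?thesis
    using g h unfolding ideal_sum_def by blast
qed

end

section \<open>The Stanley--Reisner ring of a simplicial complex\<close>

locale stanley_reisner =
  fixes V :: "'x set" and faces :: "'x set set" and R :: "('x, 'k::field) mpoly set ring"
  assumes finite_V: "finite V"
    and faces_subset: "faces \<subseteq> Pow V"
    and faces_down: "A \<in> faces \<Longrightarrow> B \<subseteq> A \<Longrightarrow> B \<in> faces"
    and R_def: "R = mpoly_ring V Quot monomial_ideal V faces"
begin

abbreviation proj :: "('x, 'k) mpoly \<Rightarrow> ('x, 'k) mpoly set" where
  "proj \<equiv> a_r_coset (mpoly_ring V) (monomial_ideal V faces)"

abbreviation monomial :: "('x \<Rightarrow>\<^sub>0 nat) \<Rightarrow> ('x, 'k) mpoly" where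
  "monomial m \<equiv> Poly_Mapping.single m 1"

lemma ideal_nonfaces: "ideal (monomial_ideal V faces :: ('x, 'k) mpoly set) (mpoly_ring V)"
  using faces_down by (rule ideal_monomial_ideal)

sublocale S: cring "mpoly_ring V :: ('x, 'k) mpoly ring"
  by (rule cring_mpoly_ring)

sublocale R: cring R
  unfolding R_def by (rule ideal.quotient_is_cring [OF ideal_nonfaces cring_mpoly_ring])

lemma proj_hom: "ring_hom_ring (mpoly_ring V) R proj"
  unfolding R_def by (rule ideal.rcos_ring_hom_ring [OF ideal_nonfaces])

lemma proj_closed [simp]: "f \<in> carrier (mpoly_ring V) \<Longrightarrow> proj f \<in> carrier R"
  using ring_hom_ring.homh [OF proj_hom] by (rule ring_hom_closed)

lemma proj_add:
  "\<lbrakk>f \<in> carrier (mpoly_ring V); g \<in> carrier (mpoly_ring V)\<rbrakk> \<Longrightarrow> proj (f + g) = proj f \<oplus>\<^bsub>R\<^esub> proj g"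
  using ring_hom_add [OF ring_hom_ring.homh [OF proj_hom], of f g] by simp

lemma proj_mult:
  "\<lbrakk>f \<in> carrier (mpoly_ring V); g \<in> carrier (mpoly_ring V)\<rbrakk> \<Longrightarrow> proj (f * g) = proj f \<otimes>\<^bsub>R\<^esub> proj g"
  using ring_hom_mult [OF ring_hom_ring.homh [OF proj_hom], of f g] by simp

lemma proj_one: "proj 1 = \<one>\<^bsub>R\<^esub>"
  using ring_hom_one [OF ring_hom_ring.homh [OF proj_hom]] by simp

lemma proj_power:
  "f \<in> carrier (mpoly_ring V) \<Longrightarrow> proj (f ^ n) = proj f [^]\<^bsub>R\<^esub> (n::nat)"
  using ring_hom_ring.hom_nat_pow [OF proj_hom, of f n] by (simp add: mpoly_ring_pow)

lemma proj_eq_iff: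
  assumes "f \<in> carrier (mpoly_ring V)" "g \<in> carrier (mpoly_ring V)"
  shows "proj f = proj g \<longleftrightarrow> f - g \<in> monomial_ideal V faces"
  using S.quotient_eq_iff_same_a_r_cos [OF ideal_nonfaces assms] assms
  by (simp add: mpoly_ring_minus)

lemma zero_in_mpoly_ring [simp]: "0 \<in> carrier (mpoly_ring V :: ('x, 'k) mpoly ring)"
  using S.zero_closed by simp

lemma proj_zero: "proj 0 = \<zero>\<^bsub>R\<^esub>"
proof -
  have "proj 0 \<oplus>\<^bsub>R\<^esub> proj 0 = proj 0"
    by (simp flip: proj_add)
  then show ?thesis
    using R.add.l_cancel_one' [of "proj 0" "proj 0"] by simp
qed

lemma proj_eq_zero_iff:
  "f \<in> carrier (mpoly_ring V) \<Longrightarrow> proj f = \<zero>\<^bsub>R\<^esub> \<longleftrightarrow> f \<in> monomial_ideal V faces"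
  using proj_eq_iff [of f 0] by (simp add: proj_zero)

lemma carrier_R: "carrier R = proj ` carrier (mpoly_ring V)"
  by (auto simp: R_def FactRing_def A_RCOSETS_def')

lemma proj_in_additive_set:
  assumes "f \<in> carrier (mpoly_ring V)" and "\<zero>\<^bsub>R\<^esub> \<in> K"
    and "\<And>a b. a \<in> K \<Longrightarrow> b \<in> K \<Longrightarrow> a \<oplus>\<^bsub>R\<^esub> b \<in> K"
    and "\<And>m. m \<in> Poly_Mapping.keys f \<Longrightarrow>
      proj (Poly_Mapping.single m (Poly_Mapping.lookup f m)) \<in> K"
  shows "proj f \<in> K"
proof -
  have "f \<in> {g \<in> carrier (mpoly_ring V). proj g \<in> K}"
    by (rule mpoly_in_additive_set)
      (use assms in \<open>auto simp: proj_zero proj_add carrier_mpoly_ring [of f]\<close>)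
  then show ?thesis by simp
qed

lemma proj_single_in_ideal:
  assumes "ideal J R" and "Poly_Mapping.keys m \<subseteq> V" and "proj (monomial m) \<in> J"
  shows "proj (Poly_Mapping.single m c) \<in> J"
proof -
  have "proj (Poly_Mapping.single 0 c * monomial m) = proj (Poly_Mapping.single 0 c) \<otimes>\<^bsub>R\<^esub> proj (monomial m)"
    using assms(2) by (intro proj_mult) simp_all
  moreover have "proj (Poly_Mapping.single 0 c) \<in> carrier R"
    by simp
  ultimately show ?thesis
    using ideal.I_l_closed [OF assms(1,3)] by (simp add: mult_single)
qed

text \<open>
  For \<open>D \<subseteq> faces\<close> the monomial ideal of \<open>D\<close> contains the ideal of nonfaces, so membership
  in its image can be tested on any representative.
\<close>

lemma proj_mem_image_iff:
  assumes f: "f \<in> carrier (mpoly_ring V)" and "D \<subseteq> faces"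
  shows "proj f \<in> proj ` monomial_ideal V D \<longleftrightarrow> f \<in> monomial_ideal V D"
proof
  assume "proj f \<in> proj ` monomial_ideal V D"
  then obtain g where g: "g \<in> monomial_ideal V D" "proj f = proj g"
    by auto
  moreover from g(1) have "g \<in> carrier (mpoly_ring V)"
    by (simp add: monomial_ideal_def)
  ultimately have "f - g \<in> monomial_ideal V faces"
    using f by (simp add: proj_eq_iff)
  moreover have "Poly_Mapping.keys f \<subseteq> Poly_Mapping.keys (f - g) \<union> Poly_Mapping.keys g"
    using keys_add [of "f - g" g] by simp
  ultimately show "f \<in> monomial_ideal V D"
    using f g(1) \<open>D \<subseteq> faces\<close> by (auto simp: monomial_ideal_def)
qed simp

definition facets :: "'x set set" where
  "facets = {F \<in> faces. \<forall>G \<in> faces. F \<subseteq> G \<longrightarrow> G = F}"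

definition face_prime :: "'x set \<Rightarrow> ('x, 'k) mpoly set set" where
  "face_prime F = proj ` monomial_ideal V (Pow F)"

lemma facet_face: "F \<in> facets \<Longrightarrow> F \<in> faces"
  by (simp add: facets_def)

lemma face_subset_V: "F \<in> faces \<Longrightarrow> F \<subseteq> V"
  using faces_subset by auto

lemma Pow_face: "F \<in> faces \<Longrightarrow> Pow F \<subseteq> faces"
  using faces_down by auto

lemma face_in_facet:
  assumes "A \<in> faces"
  obtains F where "F \<in> facets" "A \<subseteq> F"
proof -
  have "finite faces"
    using finite_V faces_subset by (meson finite_Pow_iff finite_subset)
  from finite_has_maximal2 [OF this assms] show thesis
    using that by (auto simp: facets_def)
qed

lemma proj_in_face_prime_iff:
  assumes "F \<in> faces" "f \<in> carrier (mpoly_ring V)"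
  shows "proj f \<in> face_prime F \<longleftrightarrow> (\<forall>m \<in> Poly_Mapping.keys f. \<not> Poly_Mapping.keys m \<subseteq> F)"
  using assms proj_mem_image_iff [OF assms(2) Pow_face]
  by (simp add: face_prime_def monomial_ideal_def)

lemma face_prime_subset_carrier: "face_prime F \<subseteq> carrier R"
  by (auto simp: face_prime_def carrier_R monomial_ideal_def)

lemma face_prime_antimono: "G \<subseteq> F \<Longrightarrow> face_prime F \<subseteq> face_prime G"
  unfolding face_prime_def by (intro image_mono) (auto simp: monomial_ideal_def)

lemma primeideal_face_prime:
  assumes F: "F \<in> faces"
  shows "primeideal (face_prime F) R"
proof (rule primeidealI)
  interpret P: primeideal "monomial_ideal V (Pow F)" "mpoly_ring V :: ('x, 'k) mpoly ring"
    by (rule primeideal_monomial_ideal)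
  show "ideal (face_prime F) R"
    unfolding face_prime_def R_def
    by (rule S.ring_ideal_imp_quot_ideal [OF ideal_nonfaces P.is_ideal])
  show "cring R"
    by (rule R.is_cring)
  have "proj 1 \<notin> face_prime F"
    using S.one_closed by (subst proj_in_face_prime_iff [OF F]) auto
  then show "carrier R \<noteq> face_prime F"
    using S.one_closed by (auto simp: carrier_R)
  fix a b
  assume "a \<in> carrier R" "b \<in> carrier R" and ab: "a \<otimes>\<^bsub>R\<^esub> b \<in> face_prime F"
  then obtain f g where fg: "f \<in> carrier (mpoly_ring V)" "g \<in> carrier (mpoly_ring V)"
    "a = proj f" "b = proj g"
    by (auto simp: carrier_R)
  with ab have "f * g \<in> monomial_ideal V (Pow F)"
    using proj_mem_image_iff [OF _ Pow_face [OF F], of "f * g"]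
    by (simp add: face_prime_def proj_mult)
  with fg P.I_prime [of f g] show "a \<in> face_prime F \<or> b \<in> face_prime F"
    by (auto simp: face_prime_def)
qed

subsection \<open>Prime ideals, minimal primes and their sums\<close>

definition face_monomial :: "'x set \<Rightarrow> 'x \<Rightarrow>\<^sub>0 nat" where
  "face_monomial A = (\<Sum>x\<in>A. Poly_Mapping.single x 1)"

lemma keys_face_monomial: "A \<subseteq> V \<Longrightarrow> Poly_Mapping.keys (face_monomial A) = A"
  using finite_subset [OF _ finite_V]
  by (auto simp: face_monomial_def in_keys_iff lookup_sum lookup_single when_def split: if_splits)

text \<open>
  The set of variables that stay nonzero modulo \<open>Q\<close>. It carries all the information about \<open>Q\<close>
  that the Cartier core sees.
\<close>

definition prime_face :: "('x, 'k) mpoly set set \<Rightarrow> 'x set" where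
  "prime_face Q = {x \<in> V. proj (monomial (Poly_Mapping.single x 1)) \<notin> Q}"

lemma proj_monomial_in_prime_iff:
  assumes Q: "primeideal Q R" and "Poly_Mapping.keys m \<subseteq> V"
  shows "proj (monomial m) \<in> Q \<longleftrightarrow> \<not> Poly_Mapping.keys m \<subseteq> prime_face Q"
proof -
  interpret Q: primeideal Q R by (rule Q)
  have one: "proj 1 \<notin> Q"
    using Q.one_imp_carrier Q.I_notcarr by (auto simp: proj_one)
  have mult: "proj (monomial (m + n)) \<in> Q \<longleftrightarrow> proj (monomial m) \<in> Q \<or> proj (monomial n) \<in> Q"
    if "Poly_Mapping.keys m \<subseteq> V" "Poly_Mapping.keys n \<subseteq> V" for m n
  proof -
    have "proj (monomial (m + n)) = proj (monomial m) \<otimes>\<^bsub>R\<^esub> proj (monomial n)"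
      using that by (simp add: mult_single flip: proj_mult)
    then show ?thesis
      using that Q.I_prime [of "proj (monomial m)" "proj (monomial n)"] Q.I_l_closed Q.I_r_closed
      by auto
  qed
  show ?thesis
    using assms(2)
  proof (induction m rule: poly_mapping_additive_induct)
    case (single x n)
    then show ?case
    proof (induction n)
      case 0
      then show ?case using one by simp
    next
      case (Suc n)
      then have "x \<in> V" by simp
      have "Poly_Mapping.single x (Suc n) = Poly_Mapping.single x 1 + Poly_Mapping.single x n"
        by (simp flip: single_add)
      then have "proj (monomial (Poly_Mapping.single x (Suc n))) \<in> Q \<longleftrightarrow>
          proj (monomial (Poly_Mapping.single x 1)) \<in> Q \<or> proj (monomial (Poly_Mapping.single x n)) \<in> Q"
        using \<open>x \<in> V\<close> by (simp only: mult keys_single) (simp add: mult)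
      moreover have "proj (monomial (Poly_Mapping.single x 1)) \<in> Q \<longleftrightarrow> x \<notin> prime_face Q"
        using \<open>x \<in> V\<close> by (simp add: prime_face_def)
      moreover have "proj (monomial (Poly_Mapping.single x n)) \<in> Q \<longleftrightarrow>
          \<not> Poly_Mapping.keys (Poly_Mapping.single x n) \<subseteq> prime_face Q"
        using \<open>x \<in> V\<close> by (intro Suc.IH) simp
      ultimately show ?case
        by (auto split: if_splits)
    qed
  next
    case (add m n)
    then show ?case
      by (simp add: keys_exponent_add mult)
  qed
qed

text \<open>
  The product of the variables outside \<open>Q\<close> is not in \<open>Q\<close>, in particular not zero in \<open>R\<close>.
\<close>

lemma prime_face_in_faces:
  assumes "primeideal Q R"
  shows "prime_face Q \<in> faces"
proof (rule ccontr)
  interpret Q: primeideal Q R by (rule assms)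
  let ?m = "face_monomial (prime_face Q)"
  have keys: "Poly_Mapping.keys ?m = prime_face Q" "prime_face Q \<subseteq> V"
    by (auto simp: keys_face_monomial prime_face_def)
  assume "prime_face Q \<notin> faces"
  with keys have "proj (monomial ?m) = \<zero>\<^bsub>R\<^esub>"
    by (subst proj_eq_zero_iff) simp_all
  then have "proj (monomial ?m) \<in> Q"
    using Q.zero_closed by simp
  with keys proj_monomial_in_prime_iff [OF assms, of ?m] show False
    by simp
qed

lemma face_prime_subset_prime_iff:
  assumes Q: "primeideal Q R" and F: "F \<in> faces"
  shows "face_prime F \<subseteq> Q \<longleftrightarrow> prime_face Q \<subseteq> F"
proof
  interpret Q: primeideal Q R by (rule Q)
  assume sub: "prime_face Q \<subseteq> F"
  show "face_prime F \<subseteq> Q"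
  proof
    fix a assume "a \<in> face_prime F"
    then obtain f where a: "a = proj f" and f: "f \<in> monomial_ideal V (Pow F)"
      by (auto simp: face_prime_def)
    show "a \<in> Q"
      unfolding a
    proof (rule proj_in_additive_set)
      show "f \<in> carrier (mpoly_ring V)"
        using f by (simp add: monomial_ideal_def)
      fix m assume "m \<in> Poly_Mapping.keys f"
      with f have m: "Poly_Mapping.keys m \<subseteq> V" "\<not> Poly_Mapping.keys m \<subseteq> F"
        by (auto simp: monomial_ideal_def carrier_mpoly_ring)
      with sub have "proj (monomial m) \<in> Q"
        by (subst proj_monomial_in_prime_iff [OF Q]) auto
      then show "proj (Poly_Mapping.single m (Poly_Mapping.lookup f m)) \<in> Q"
        by (rule proj_single_in_ideal [OF Q.is_ideal m(1)])
    qed (use Q.zero_closed Q.a_closed in auto)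
  qed
next
  assume sub: "face_prime F \<subseteq> Q"
  let ?m = "face_monomial (prime_face Q)"
  have keys: "Poly_Mapping.keys ?m = prime_face Q" "prime_face Q \<subseteq> V"
    by (auto simp: keys_face_monomial prime_face_def)
  then have "proj (monomial ?m) \<notin> Q"
    using proj_monomial_in_prime_iff [OF Q, of ?m] by simp
  with sub have "proj (monomial ?m) \<notin> face_prime F"
    by blast
  with keys show "prime_face Q \<subseteq> F"
    by (simp add: proj_in_face_prime_iff F)
qed

lemma prime_contains_facet_prime:
  assumes "primeideal Q R"
  obtains F where "F \<in> facets" "face_prime F \<subseteq> Q"
  using face_in_facet [OF prime_face_in_faces [OF assms]] face_prime_subset_prime_iff [OF assms]
  by (metis facet_face)

lemma face_prime_subset_imp:
  assumes "F \<in> faces" "G \<in> faces" "face_prime F \<subseteq> face_prime G"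
  shows "G \<subseteq> F"
proof -
  let ?m = "face_monomial G"
  have keys: "Poly_Mapping.keys ?m = G" "G \<subseteq> V"
    using face_subset_V [OF assms(2)] by (auto simp: keys_face_monomial)
  then have "proj (monomial ?m) \<notin> face_prime G"
    by (simp add: proj_in_face_prime_iff assms(2))
  with assms(3) have "proj (monomial ?m) \<notin> face_prime F"
    by blast
  with keys show ?thesis
    by (simp add: proj_in_face_prime_iff assms(1))
qed

text \<open>
  Every prime contains the prime of some facet, and the primes of distinct facets are incomparable
  because facets are.
\<close>

lemma minimal_primes_eq: "minimal_primes R = face_prime ` facets"
proof
  show "minimal_primes R \<subseteq> face_prime ` facets"
  proof
    fix P assume "P \<in> minimal_primes R"
    then have P: "primeideal P R" "\<And>P'. primeideal P' R \<Longrightarrow> P' \<subseteq> P \<Longrightarrow> P' = P"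
      by (auto simp: minimal_primes_def)
    obtain F where "F \<in> facets" "face_prime F \<subseteq> P"
      using prime_contains_facet_prime [OF P(1)] .
    with P(2) [OF primeideal_face_prime] show "P \<in> face_prime ` facets"
      using facet_face by blast
  qed
next
  show "face_prime ` facets \<subseteq> minimal_primes R"
  proof clarify
    fix F assume F: "F \<in> facets"
    have "P = face_prime F" if P: "primeideal P R" "P \<subseteq> face_prime F" for P
    proof -
      obtain G where G: "G \<in> facets" "face_prime G \<subseteq> P"
        using prime_contains_facet_prime [OF P(1)] .
      with P(2) have "F \<subseteq> G"
        using face_prime_subset_imp F facet_face by blast
      with F G have "G = F"
        by (simp add: facets_def)
      with G P show ?thesis by blast
    qed
    then show "face_prime F \<in> minimal_primes R"
      using primeideal_face_prime F facet_face by (simp add: minimal_primes_def)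
  qed
qed

lemma ideal_minimal_prime: "P \<in> minimal_primes R \<Longrightarrow> ideal P R"
  by (simp add: minimal_primes_def primeideal_def)

text \<open>
  A monomial is supported in every \<open>F \<in> \<F>\<close> or lies in one of the summands. The sum is
  therefore again the prime of a face, although in general not of a facet.
\<close>

lemma ideal_sum_face_primes:
  assumes "\<F> \<subseteq> facets" "\<F> \<noteq> {}"
  shows "ideal_sum R (face_prime ` \<F>) (\<lambda>P. P) = face_prime (\<Inter>\<F>)"
proof
  have sub: "P \<subseteq> carrier R" if "P \<in> face_prime ` \<F>" for P
    using that face_prime_subset_carrier by blast
  obtain F where F: "F \<in> \<F>" "F \<in> faces"
    using assms facet_face by blast
  then have "\<Inter>\<F> \<in> faces"
    using faces_down by blast
  then interpret Q: primeideal "face_prime (\<Inter>\<F>)" R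
    by (rule primeideal_face_prime)
  show "ideal_sum R (face_prime ` \<F>) (\<lambda>P. P) \<subseteq> face_prime (\<Inter>\<F>)"
  proof (rule R.ideal_sum_least)
    fix P assume "P \<in> face_prime ` \<F>"
    then show "P \<subseteq> face_prime (\<Inter>\<F>)"
      using face_prime_antimono by blast
  qed (use Q.a_subset Q.zero_closed Q.a_closed in auto)
  show "face_prime (\<Inter>\<F>) \<subseteq> ideal_sum R (face_prime ` \<F>) (\<lambda>P. P)"
  proof
    fix a assume "a \<in> face_prime (\<Inter>\<F>)"
    then obtain f where a: "a = proj f" and f: "f \<in> monomial_ideal V (Pow (\<Inter>\<F>))"
      by (auto simp: face_prime_def)
    show "a \<in> ideal_sum R (face_prime ` \<F>) (\<lambda>P. P)"
      unfolding a
    proof (rule proj_in_additive_set)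
      fix m assume "m \<in> Poly_Mapping.keys f"
      with f have m: "Poly_Mapping.keys m \<subseteq> V" "\<not> Poly_Mapping.keys m \<subseteq> \<Inter>\<F>"
        by (auto simp: monomial_ideal_def carrier_mpoly_ring)
      then obtain G where "G \<in> \<F>" "\<not> Poly_Mapping.keys m \<subseteq> G"
        by blast
      with m(1) have "proj (Poly_Mapping.single m (Poly_Mapping.lookup f m)) \<in> face_prime G"
        by (simp add: face_prime_def)
      moreover have "face_prime G \<subseteq> ideal_sum R (face_prime ` \<F>) (\<lambda>P. P)"
        using R.ideal_sum_incl [of "face_prime G" "face_prime ` \<F>" "\<lambda>P. P"] \<open>G \<in> \<F>\<close> sub by blast
      ultimately show "proj (Poly_Mapping.single m (Poly_Mapping.lookup f m))
          \<in> ideal_sum R (face_prime ` \<F>) (\<lambda>P. P)"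
        by blast
    next
      have "ideal P R" if "P \<in> face_prime ` \<F>" for P
        using that assms(1) minimal_primes_eq by (intro ideal_minimal_prime) auto
      then show "b \<oplus>\<^bsub>R\<^esub> c \<in> ideal_sum R (face_prime ` \<F>) (\<lambda>P. P)"
        if "b \<in> ideal_sum R (face_prime ` \<F>) (\<lambda>P. P)"
          "c \<in> ideal_sum R (face_prime ` \<F>) (\<lambda>P. P)" for b c
        using that by (intro R.ideal_sum_add_closed)
    qed (use f R.zero_in_ideal_sum in \<open>auto simp: monomial_ideal_def\<close>)
  qed
qed

end

section \<open>Frobenius-linear maps on a Stanley--Reisner ring\<close>

lemma frob_hom_iff:
  "\<phi> \<in> frob_hom p e R \<longleftrightarrow>
     \<phi> \<in> carrier R \<rightarrow> carrier R \<and>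
     (\<forall>a\<in>carrier R. \<forall>b\<in>carrier R. \<phi> (a \<oplus>\<^bsub>R\<^esub> b) = \<phi> a \<oplus>\<^bsub>R\<^esub> \<phi> b) \<and>
     (\<forall>r\<in>carrier R. \<forall>a\<in>carrier R. \<phi> ((r [^]\<^bsub>R\<^esub> (p ^ e)) \<otimes>\<^bsub>R\<^esub> a) = r \<otimes>\<^bsub>R\<^esub> \<phi> a)"
  by (auto simp: frob_hom_def LinearCombinations.module_hom_def frob_pushforward_def self_module_def)

lemma frob_hom_closed: "\<phi> \<in> frob_hom p e R \<Longrightarrow> a \<in> carrier R \<Longrightarrow> \<phi> a \<in> carrier R"
  by (auto simp: frob_hom_iff)

lemma frob_hom_add:
  "\<lbrakk>\<phi> \<in> frob_hom p e R; a \<in> carrier R; b \<in> carrier R\<rbrakk> \<Longrightarrow> \<phi> (a \<oplus>\<^bsub>R\<^esub> b) = \<phi> a \<oplus>\<^bsub>R\<^esub> \<phi> b"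
  by (auto simp: frob_hom_iff)

lemma frob_hom_smult:
  "\<lbrakk>\<phi> \<in> frob_hom p e R; r \<in> carrier R; a \<in> carrier R\<rbrakk> \<Longrightarrow>
     \<phi> ((r [^]\<^bsub>R\<^esub> (p ^ e)) \<otimes>\<^bsub>R\<^esub> a) = r \<otimes>\<^bsub>R\<^esub> \<phi> a"
  by (auto simp: frob_hom_iff)

lemma (in ring) frob_hom_zero:
  assumes "\<phi> \<in> frob_hom p e R"
  shows "\<phi> \<zero> = \<zero>"
proof -
  have "\<phi> \<zero> \<oplus> \<phi> \<zero> = \<phi> \<zero>"
    using frob_hom_add [OF assms zero_closed zero_closed] by simp
  then show ?thesis
    using add.l_cancel_one' [of "\<phi> \<zero>" "\<phi> \<zero>"] frob_hom_closed [OF assms zero_closed] by simp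
qed

lemma uniformly_F_compatible_subset_cartier_core:
  assumes "uniformly_F_compatible p R J" "J \<subseteq> carrier R"
  shows "J \<subseteq> cartier_core p R J"
  using assms by (auto simp: uniformly_F_compatible_def cartier_core_def)

lemma (in ring) uniformly_F_compatible_ideal_sum:
  assumes "\<And>i. i \<in> T \<Longrightarrow> ideal (A i) R" and "\<And>i. i \<in> T \<Longrightarrow> uniformly_F_compatible p R (A i)"
  shows "uniformly_F_compatible p R (ideal_sum R T A)"
  unfolding uniformly_F_compatible_def
proof (intro allI ballI)
  fix e \<phi> assume \<phi>: "\<phi> \<in> frob_hom p e R"
  have "ideal_sum R T A \<subseteq> {a \<in> carrier R. \<phi> a \<in> ideal_sum R T A}"
  proof (rule ideal_sum_least)
    fix i assume i: "i \<in> T"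
    have "A i \<subseteq> carrier R"
      using assms(1) [OF i] by (simp add: additive_subgroup.a_subset ideal.axioms(1))
    with i assms(2) [OF i] \<phi> ideal_sum_incl [of i T A]
    show "A i \<subseteq> {a \<in> carrier R. \<phi> a \<in> ideal_sum R T A}"
      by (auto simp: uniformly_F_compatible_def)
  qed (use assms(1) \<phi> in \<open>auto simp: frob_hom_zero frob_hom_add zero_in_ideal_sum intro: ideal_sum_add_closed\<close>)
  then show "\<phi> ` ideal_sum R T A \<subseteq> ideal_sum R T A"
    by blast
qed

lemma (in ring) ideal_carrier_Inter:
  assumes "\<And>P. P \<in> \<Q> \<Longrightarrow> ideal P R"
  shows "ideal (carrier R \<inter> \<Inter>\<Q>) R"
  using i_Intersect [of "insert (carrier R) \<Q>"] assms oneideal by auto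

context stanley_reisner
begin

text \<open>
  Let \<open>s\<close> be the product of the variables in \<open>F\<close>. As \<open>F\<close> is a facet, \<open>s\<close> annihilates
  \<open>P\<^sub>F\<close>, so \<open>s \<phi>(a) = \<phi>(s\<^sup>q a) = 0\<close> for \<open>a \<in> P\<^sub>F\<close>; and \<open>s \<notin> P\<^sub>F\<close> forces
  \<open>\<phi>(a) \<in> P\<^sub>F\<close>.
\<close>

lemma uniformly_F_compatible_minimal_prime:
  assumes "p > 0" and F: "F \<in> facets"
  shows "uniformly_F_compatible p R (face_prime F)"
  unfolding uniformly_F_compatible_def
proof clarify
  fix e \<phi> a
  assume \<phi>: "\<phi> \<in> frob_hom p e R" and a: "a \<in> face_prime F"
  note face = facet_face [OF F]
  interpret P: primeideal "face_prime F" R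
    using face by (rule primeideal_face_prime)
  let ?m = "face_monomial F" and ?s = "proj (monomial (face_monomial F))"
  have keys: "Poly_Mapping.keys ?m = F" "F \<subseteq> V"
    using face_subset_V [OF face] by (simp_all add: keys_face_monomial)
  then have s: "?s \<in> carrier R" "?s \<notin> face_prime F"
    using proj_in_face_prime_iff [OF face, of "monomial ?m"] by simp_all
  obtain f where f: "a = proj f" "f \<in> monomial_ideal V (Pow F)"
    using a by (auto simp: face_prime_def)
  then have fc: "f \<in> carrier (mpoly_ring V)"
    by (simp add: monomial_ideal_def)
  have "monomial ?m * f \<in> monomial_ideal V faces"
  proof -
    have "Poly_Mapping.keys k \<notin> faces" if k: "k \<in> Poly_Mapping.keys (monomial ?m * f)" for k
    proof -
      obtain n where n: "k = ?m + n" "n \<in> Poly_Mapping.keys f"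
        using keys_mult [of "monomial ?m" f] k by auto
      with f(2) have "\<not> Poly_Mapping.keys n \<subseteq> F"
        by (auto simp: monomial_ideal_def)
      with F show ?thesis
        by (auto simp: n keys_exponent_add keys facets_def)
    qed
    with fc keys show ?thesis
      by (simp add: monomial_ideal_def)
  qed
  then have sa: "?s \<otimes>\<^bsub>R\<^esub> a = \<zero>\<^bsub>R\<^esub>"
    using fc keys unfolding f(1) by (subst proj_mult [symmetric]) (simp_all add: proj_eq_zero_iff)
  have ac: "a \<in> carrier R"
    using a P.a_subset by blast
  from \<open>p > 0\<close> obtain k where k: "p ^ e = Suc k"
    by (metis gr0_implies_Suc zero_less_power)
  have "(?s [^]\<^bsub>R\<^esub> (p ^ e)) \<otimes>\<^bsub>R\<^esub> a = \<zero>\<^bsub>R\<^esub>"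
    using s(1) ac sa by (simp add: k R.m_assoc)
  then have "?s \<otimes>\<^bsub>R\<^esub> \<phi> a = \<zero>\<^bsub>R\<^esub>"
    using frob_hom_smult [OF \<phi> s(1) ac] R.frob_hom_zero [OF \<phi>] by simp
  then show "\<phi> a \<in> face_prime F"
    using P.I_prime [OF s(1) frob_hom_closed [OF \<phi> ac]] s(2) P.zero_closed by auto
qed

text \<open>
  The map is induced by \<open>T g = x\<^sup>n Tr\<^sub>m g\<close> with the trace defined above. The condition on
  facets says precisely that \<open>T\<close> preserves the ideal of nonfaces: if \<open>x\<^bsup>m + q d\<^esup>\<close> is sent
  to a nonzero \<open>x\<^bsup>n + d\<^esup>\<close> of \<open>R\<close>, then a facet containing the supports of \<open>n\<close> and \<open>d\<close>
  contains that of \<open>m\<close> as well, so \<open>x\<^bsup>m + q d\<^esup>\<close> was nonzero in \<open>R\<close>.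
\<close>

lemma exists_trace_frob_hom:
  assumes "prime p" and char: "CHAR('k) = p"
    and f: "f \<in> carrier (mpoly_ring V)" and m: "m \<in> Poly_Mapping.keys f"
    and n: "Poly_Mapping.keys n \<subseteq> V"
    and small: "\<And>k x. k \<in> Poly_Mapping.keys f \<Longrightarrow> Poly_Mapping.lookup k x < p ^ e"
    and link: "\<And>F. F \<in> facets \<Longrightarrow> Poly_Mapping.keys n \<subseteq> F \<Longrightarrow> Poly_Mapping.keys m \<subseteq> F"
  obtains \<phi> where "\<phi> \<in> frob_hom p e R" and "\<phi> (proj f) = proj (monomial n)"
proof -
  have "Poly_Mapping.lookup f m \<noteq> 0"
    using m by (simp add: in_keys_iff)
  then obtain l where l: "\<And>x y. l (x + y) = l x + l y" "\<And>a x. l (a ^ (p ^ e) * x) = a * l x"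
    "l (Poly_Mapping.lookup f m) = 1"
    using frobenius_functional [of "p ^ e" e "Poly_Mapping.lookup f m"] assms(1,2) by metis
  interpret frobenius_trace l "p ^ e" e
    by standard (use assms l in auto)
  define T where "T f = monomial n * monomial_trace l (p ^ e) m f" for f
  have T_add: "T (f + g) = T f + T g" for f g
    by (simp add: T_def trace_add distrib_left)
  have T_keys: "\<exists>d. k = n + d \<and> m + scale_exponent (p ^ e) d \<in> Poly_Mapping.keys f"
    if k: "k \<in> Poly_Mapping.keys (T f)" for f k
  proof -
    obtain d where d: "k = n + d" "d \<in> Poly_Mapping.keys (monomial_trace l (p ^ e) m f)"
      using k keys_mult [of "monomial n"] unfolding T_def by fastforce
    from d(2) have "Poly_Mapping.lookup f (m + scale_exponent (p ^ e) d) \<noteq> 0"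
      by (auto simp: in_keys_iff lookup_trace)
    with d(1) show ?thesis
      by (auto simp: in_keys_iff)
  qed
  have keys_shift: "Poly_Mapping.keys (m + scale_exponent (p ^ e) d) =
      Poly_Mapping.keys m \<union> Poly_Mapping.keys d" for d
    using q_pos by (simp add: keys_exponent_add)
  have T_closed: "T f \<in> carrier (mpoly_ring V)" if "f \<in> carrier (mpoly_ring V)" for f
    unfolding carrier_mpoly_ring
  proof
    fix k assume "k \<in> Poly_Mapping.keys (T f)"
    then obtain d where d: "k = n + d" "m + scale_exponent (p ^ e) d \<in> Poly_Mapping.keys f"
      using T_keys by blast
    with that have "Poly_Mapping.keys d \<subseteq> V"
      using keys_shift by (auto simp: carrier_mpoly_ring)
    with n show "Poly_Mapping.keys k \<subseteq> V"
      by (simp add: d keys_exponent_add)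
  qed
  have T_nonfaces: "T f \<in> monomial_ideal V faces" if f: "f \<in> monomial_ideal V faces" for f
  proof -
    have "Poly_Mapping.keys k \<notin> faces" if "k \<in> Poly_Mapping.keys (T f)" for k
    proof
      assume "Poly_Mapping.keys k \<in> faces"
      then obtain F where F: "F \<in> facets" "Poly_Mapping.keys k \<subseteq> F"
        by (rule face_in_facet)
      obtain d where d: "k = n + d" "m + scale_exponent (p ^ e) d \<in> Poly_Mapping.keys f"
        using T_keys \<open>k \<in> _\<close> by blast
      from F(2) have "Poly_Mapping.keys n \<subseteq> F" "Poly_Mapping.keys d \<subseteq> F"
        by (simp_all add: d keys_exponent_add)
      with link [OF F(1)] have "Poly_Mapping.keys (m + scale_exponent (p ^ e) d) \<subseteq> F"
        by (simp add: keys_shift)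
      with facet_face [OF F(1)] have "Poly_Mapping.keys (m + scale_exponent (p ^ e) d) \<in> faces"
        by (rule faces_down)
      with f d(2) show False
        by (auto simp: monomial_ideal_def)
    qed
    with f T_closed show ?thesis
      by (simp add: monomial_ideal_def)
  qed
  \<comment> \<open>An element of \<open>R\<close> is a coset; the choice of representative is immaterial by \<open>T_nonfaces\<close>.\<close>
  define \<phi> where "\<phi> a = proj (T (SOME f. f \<in> carrier (mpoly_ring V) \<and> a = proj f))" for a
  have \<phi>_proj: "\<phi> (proj f) = proj (T f)" if f: "f \<in> carrier (mpoly_ring V)" for f
  proof -
    define g where "g = (SOME g. g \<in> carrier (mpoly_ring V) \<and> proj f = proj g)"
    have "g \<in> carrier (mpoly_ring V) \<and> proj f = proj g"
      unfolding g_def by (rule someI [of _ f]) (simp add: f)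
    then have g: "g \<in> carrier (mpoly_ring V)" "proj g = proj f"
      by simp_all
    have "T g = T (g - f) + T f"
      by (simp flip: T_add)
    moreover have "T (g - f) \<in> monomial_ideal V faces"
      using f g by (intro T_nonfaces) (simp flip: proj_eq_iff)
    ultimately have "T g - T f \<in> monomial_ideal V faces"
      by simp
    then have "proj (T g) = proj (T f)"
      using proj_eq_iff [OF T_closed [OF g(1)] T_closed [OF f]] by simp
    then show ?thesis
      by (simp add: \<phi>_def g_def)
  qed
  have "\<phi> \<in> frob_hom p e R"
    unfolding frob_hom_iff
  proof (intro conjI ballI funcsetI)
    fix a assume "a \<in> carrier R"
    then show "\<phi> a \<in> carrier R"
      by (auto simp: carrier_R \<phi>_proj T_closed)
  next
    fix a b assume "a \<in> carrier R" "b \<in> carrier R"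
    then obtain f g where "f \<in> carrier (mpoly_ring V)" "g \<in> carrier (mpoly_ring V)"
      "a = proj f" "b = proj g"
      by (auto simp: carrier_R)
    then show "\<phi> (a \<oplus>\<^bsub>R\<^esub> b) = \<phi> a \<oplus>\<^bsub>R\<^esub> \<phi> b"
      by (simp add: \<phi>_proj T_closed T_add flip: proj_add)
  next
    fix r a assume "r \<in> carrier R" "a \<in> carrier R"
    then obtain g f where fg: "g \<in> carrier (mpoly_ring V)" "f \<in> carrier (mpoly_ring V)"
      "r = proj g" "a = proj f"
      by (auto simp: carrier_R)
    have pow: "g ^ (p ^ e) \<in> carrier (mpoly_ring V)"
      using S.nat_pow_closed [OF fg(1), of "p ^ e"] by (simp add: mpoly_ring_pow)
    have "(r [^]\<^bsub>R\<^esub> (p ^ e)) \<otimes>\<^bsub>R\<^esub> a = proj (g ^ (p ^ e) * f)"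
      using fg pow by (simp add: proj_power proj_mult)
    then have "\<phi> ((r [^]\<^bsub>R\<^esub> (p ^ e)) \<otimes>\<^bsub>R\<^esub> a) = proj (T (g ^ (p ^ e) * f))"
      using fg pow by (simp only: \<phi>_proj S.m_closed [simplified])
    also have "T (g ^ (p ^ e) * f) = g * T f"
      using trace_power_mult [OF small [OF m], where g = g and f = f] by (simp add: T_def ac_simps)
    also have "proj (g * T f) = r \<otimes>\<^bsub>R\<^esub> \<phi> a"
      using fg by (simp add: \<phi>_proj T_closed proj_mult)
    finally show "\<phi> ((r [^]\<^bsub>R\<^esub> (p ^ e)) \<otimes>\<^bsub>R\<^esub> a) = r \<otimes>\<^bsub>R\<^esub> \<phi> a" .
  qed
  moreover have "\<phi> (proj f) = proj (monomial n)"
    using f trace_isolates [OF small, where m = m] by (simp add: \<phi>_proj T_def mult_single l(3))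
  ultimately show thesis
    using that by blast
qed

end

section \<open>Cartier cores\<close>

locale stanley_reisner_prime_char = stanley_reisner V faces R
  for V :: "'x set" and faces and R :: "('x, 'k::field) mpoly set ring" +
  fixes p :: nat
  assumes prime_p: "prime p" and char_p: "CHAR('k) = p"
begin

lemma p_pos: "p > 0"
  using prime_p by (rule prime_gt_0_nat)

text \<open>
  The heart of the argument. A term \<open>x\<^sup>n\<close> of a member of the intersection satisfies the condition
  on facets of \<open>exists_trace_frob_hom\<close>: if a facet \<open>F\<close> contains the support of
  \<open>n\<close> but not that of \<open>m\<close>, then \<open>P\<^sub>F\<close> is one of the intersected primes, and none of its
  members has a term supported in \<open>F\<close>. So some
  \<open>\<phi>\<close> sends \<open>f\<close> to \<open>x\<^sup>n\<close>, and \<open>x\<^sup>n \<in> J\<close> by the definition of the Cartier core.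
\<close>

lemma cartier_core_monomial:
  assumes J: "ideal J R" and f: "f \<in> carrier (mpoly_ring V)" "proj f \<in> cartier_core p R J"
    and m: "m \<in> Poly_Mapping.keys f"
  shows "carrier R \<inter> \<Inter> (face_prime ` {F \<in> facets. \<not> Poly_Mapping.keys m \<subseteq> F}) \<subseteq> J"
proof
  interpret J: ideal J R by (rule J)
  fix a assume a: "a \<in> carrier R \<inter> \<Inter> (face_prime ` {F \<in> facets. \<not> Poly_Mapping.keys m \<subseteq> F})"
  then obtain h where h: "a = proj h" "h \<in> carrier (mpoly_ring V)"
    by (auto simp: carrier_R)
  have "finite (\<Union>k\<in>Poly_Mapping.keys f. Poly_Mapping.lookup k ` Poly_Mapping.keys k)"
    by simp
  then obtain B where B: "\<And>k x. k \<in> Poly_Mapping.keys f \<Longrightarrow> x \<in> Poly_Mapping.keys k \<Longrightarrow>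
      Poly_Mapping.lookup k x \<le> B"
    unfolding finite_nat_set_iff_bounded_le by blast
  \<comment> \<open>The exponent \<open>e = Suc B\<close> is positive, and \<open>p\<^sup>e\<close> exceeds every exponent of \<open>f\<close>.\<close>
  have "Suc B < p ^ Suc B"
    using prime_gt_Suc_0_nat [OF prime_p] by (rule power_gt_expt)
  then have "B < p ^ Suc B"
    by (rule Suc_lessD)
  have small: "Poly_Mapping.lookup k x < p ^ Suc B" if "k \<in> Poly_Mapping.keys f" for k x
  proof (cases "x \<in> Poly_Mapping.keys k")
    case True
    from B [OF that True] \<open>B < p ^ Suc B\<close> show ?thesis
      by (rule le_less_trans)
  next
    case False
    then show ?thesis
      using p_pos by (simp add: in_keys_iff)
  qed
  show "a \<in> J"
    unfolding h(1)
  proof (rule proj_in_additive_set [OF h(2)])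
    fix n assume n: "n \<in> Poly_Mapping.keys h"
    have link: "Poly_Mapping.keys m \<subseteq> F" if F: "F \<in> facets" "Poly_Mapping.keys n \<subseteq> F" for F
    proof (rule ccontr)
      assume "\<not> Poly_Mapping.keys m \<subseteq> F"
      with a F(1) have "proj h \<in> face_prime F"
        by (auto simp: h)
      with h(2) n F show False
        by (simp add: proj_in_face_prime_iff facet_face)
    qed
    have keys: "Poly_Mapping.keys n \<subseteq> V"
      using h(2) n by (simp add: carrier_mpoly_ring)
    obtain \<phi> where "\<phi> \<in> frob_hom p (Suc B) R" "\<phi> (proj f) = proj (monomial n)"
      by (rule exists_trace_frob_hom [OF prime_p char_p f(1) m keys small link])
    then have "proj (monomial n) \<in> J"
      using f(2) by (force simp: cartier_core_def)
    then show "proj (Poly_Mapping.single n (Poly_Mapping.lookup h n)) \<in> J"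
      by (rule proj_single_in_ideal [OF J keys])
  qed (use J.zero_closed J.a_closed in auto)
qed

theorem cartier_core_eq:
  assumes J: "ideal J R"
  shows "cartier_core p R J =
    ideal_sum R {\<Q>. \<Q> \<subseteq> minimal_primes R \<and> carrier R \<inter> \<Inter>\<Q> \<subseteq> J} (\<lambda>\<Q>. carrier R \<inter> \<Inter>\<Q>)"
    (is "_ = ideal_sum R ?T ?A")
proof
  interpret J: ideal J R by (rule J)
  have ideals: "ideal (?A \<Q>) R" if "\<Q> \<in> ?T" for \<Q>
    using that by (intro R.ideal_carrier_Inter ideal_minimal_prime) auto
  have closed: "a \<oplus>\<^bsub>R\<^esub> b \<in> ideal_sum R ?T ?A"
    if "a \<in> ideal_sum R ?T ?A" "b \<in> ideal_sum R ?T ?A" for a b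
    using ideals that by (rule R.ideal_sum_add_closed)
  show "cartier_core p R J \<subseteq> ideal_sum R ?T ?A"
  proof
    fix a assume a: "a \<in> cartier_core p R J"
    then obtain f where f: "a = proj f" "f \<in> carrier (mpoly_ring V)"
      by (auto simp: cartier_core_def carrier_R)
    show "a \<in> ideal_sum R ?T ?A"
      unfolding f(1)
    proof (rule proj_in_additive_set [OF f(2)])
      fix m assume m: "m \<in> Poly_Mapping.keys f"
      let ?\<Q> = "face_prime ` {F \<in> facets. \<not> Poly_Mapping.keys m \<subseteq> F}"
      have "?\<Q> \<in> ?T"
        using cartier_core_monomial [OF J f(2) _ m] a f(1) by (auto simp: minimal_primes_eq)
      then have "?A ?\<Q> \<subseteq> ideal_sum R ?T ?A"
        by (rule R.ideal_sum_incl) simp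
      moreover have "Poly_Mapping.keys m \<subseteq> V"
        using f(2) m by (simp add: carrier_mpoly_ring)
      then have "proj (Poly_Mapping.single m (Poly_Mapping.lookup f m)) \<in> ?A ?\<Q>"
        by (auto simp: face_prime_def)
      ultimately show "proj (Poly_Mapping.single m (Poly_Mapping.lookup f m)) \<in> ideal_sum R ?T ?A"
        by blast
    qed (use R.zero_in_ideal_sum closed in auto)
  qed
  show "ideal_sum R ?T ?A \<subseteq> cartier_core p R J"
  proof (rule R.ideal_sum_least)
    fix \<Q> assume \<Q>: "\<Q> \<in> ?T"
    show "?A \<Q> \<subseteq> cartier_core p R J"
    proof
      fix a assume a: "a \<in> ?A \<Q>"
      have "\<phi> a \<in> J" if \<phi>: "\<phi> \<in> frob_hom p e R" for e \<phi>
      proof -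
        have "\<phi> a \<in> P" if P: "P \<in> \<Q>" for P
        proof -
          obtain F where "F \<in> facets" "P = face_prime F"
            using P \<Q> by (auto simp: minimal_primes_eq)
          with P a \<phi> show ?thesis
            using uniformly_F_compatible_minimal_prime [OF p_pos]
            unfolding uniformly_F_compatible_def by blast
        qed
        moreover have "\<phi> a \<in> carrier R"
          using \<phi> a by (simp add: frob_hom_closed)
        ultimately show ?thesis
          using \<Q> by blast
      qed
      with a show "a \<in> cartier_core p R J"
        by (simp add: cartier_core_def)
    qed
  qed (use J.zero_closed J.a_closed in
      \<open>auto simp: cartier_core_def R.frob_hom_zero frob_hom_add\<close>)
qed

text \<open>
  The monomial \<open>x\<^sup>A\<close>, where \<open>A\<close> is the face of \<open>Q\<close>, replaces prime avoidance: being outside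
  \<open>Q\<close> it is outside every intersection contained in \<open>Q\<close>, hence outside some minimal prime
  \<open>P\<^sub>F\<close> of the family, and then \<open>A \<subseteq> F\<close> gives \<open>P\<^sub>F \<subseteq> Q\<close>.
\<close>

theorem cartier_core_prime_eq:
  assumes Q: "primeideal Q R"
  shows "cartier_core p R Q = ideal_sum R {P \<in> minimal_primes R. P \<subseteq> Q} (\<lambda>P. P)"
proof -
  interpret Q: primeideal Q R by (rule Q)
  let ?T = "{\<Q>. \<Q> \<subseteq> minimal_primes R \<and> carrier R \<inter> \<Inter>\<Q> \<subseteq> Q}"
  let ?A = "\<lambda>\<Q>. carrier R \<inter> \<Inter>\<Q>"
  let ?T' = "{P \<in> minimal_primes R. P \<subseteq> Q}"
  have ideals: "ideal (?A \<Q>) R" if "\<Q> \<in> ?T" for \<Q>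
    using that by (intro R.ideal_carrier_Inter ideal_minimal_prime) auto
  have ideals': "ideal P R" if "P \<in> ?T'" for P
    using that by (intro ideal_minimal_prime) auto
  have sub: "P \<subseteq> carrier R" if "P \<in> minimal_primes R" for P
    using ideal_minimal_prime [OF that] by (simp add: additive_subgroup.a_subset ideal.axioms(1))
  have closed: "a \<oplus>\<^bsub>R\<^esub> b \<in> ideal_sum R ?T ?A"
    if "a \<in> ideal_sum R ?T ?A" "b \<in> ideal_sum R ?T ?A" for a b
    using ideals that by (rule R.ideal_sum_add_closed)
  have closed': "a \<oplus>\<^bsub>R\<^esub> b \<in> ideal_sum R ?T' (\<lambda>P. P)"
    if "a \<in> ideal_sum R ?T' (\<lambda>P. P)" "b \<in> ideal_sum R ?T' (\<lambda>P. P)" for a b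
    using ideals' that by (rule R.ideal_sum_add_closed)
  have carr: "ideal_sum R ?T ?A \<subseteq> carrier R"
    by (rule R.ideal_sum_least) auto
  have carr': "ideal_sum R ?T' (\<lambda>P. P) \<subseteq> carrier R"
    by (rule R.ideal_sum_least) (use sub in auto)
  have "ideal_sum R ?T ?A = ideal_sum R ?T' (\<lambda>P. P)"
  proof
    show "ideal_sum R ?T ?A \<subseteq> ideal_sum R ?T' (\<lambda>P. P)"
    proof (rule R.ideal_sum_least)
      fix \<Q> assume \<Q>: "\<Q> \<in> ?T"
      let ?m = "face_monomial (prime_face Q)"
      have keys: "Poly_Mapping.keys ?m = prime_face Q" "prime_face Q \<subseteq> V"
        by (auto simp: keys_face_monomial prime_face_def)
      then have "proj (monomial ?m) \<notin> Q" "proj (monomial ?m) \<in> carrier R"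
        using proj_monomial_in_prime_iff [OF Q, of ?m] by simp_all
      with \<Q> obtain P where P: "P \<in> \<Q>" "proj (monomial ?m) \<notin> P"
        by blast
      with \<Q> have "P \<in> face_prime ` facets"
        by (auto simp: minimal_primes_eq)
      then obtain F where F: "F \<in> faces" "P = face_prime F"
        using facet_face by blast
      with P(2) keys have "prime_face Q \<subseteq> F"
        by (simp add: proj_in_face_prime_iff)
      with F have "P \<subseteq> Q"
        by (simp add: face_prime_subset_prime_iff [OF Q])
      with P(1) \<Q> have "P \<in> ?T'"
        by blast
      with P(1) show "?A \<Q> \<subseteq> ideal_sum R ?T' (\<lambda>P. P)"
        using R.ideal_sum_incl [of P ?T' "\<lambda>P. P"] sub by blast
    qed (use R.zero_in_ideal_sum closed' carr' in auto)
    show "ideal_sum R ?T' (\<lambda>P. P) \<subseteq> ideal_sum R ?T ?A"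
    proof (rule R.ideal_sum_least)
      fix P assume P: "P \<in> ?T'"
      then have "{P} \<in> ?T" "?A {P} = P"
        using sub by auto
      then show "P \<subseteq> ideal_sum R ?T ?A"
        using R.ideal_sum_incl [of "{P}" ?T ?A] by auto
    qed (use R.zero_in_ideal_sum closed carr in auto)
  qed
  then show ?thesis
    using cartier_core_eq [OF Q.is_ideal] by simp
qed

lemma cartier_core_prime_subset:
  assumes "primeideal Q R"
  shows "cartier_core p R Q \<subseteq> Q"
proof -
  interpret Q: primeideal Q R by (rule assms)
  show ?thesis
    unfolding cartier_core_prime_eq [OF assms]
    by (rule R.ideal_sum_least) (use Q.a_subset Q.zero_closed Q.a_closed in auto)
qed

lemma sum_of_minimal_primes:
  assumes "\<P> \<subseteq> minimal_primes R" "\<P> \<noteq> {}"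
  shows "primeideal (ideal_sum R \<P> (\<lambda>P. P)) R"
    and "uniformly_F_compatible p R (ideal_sum R \<P> (\<lambda>P. P))"
proof -
  obtain \<F> where \<F>: "\<F> \<subseteq> facets" "\<P> = face_prime ` \<F>"
    using assms(1) unfolding minimal_primes_eq subset_image_iff by blast
  with assms(2) obtain F where "F \<in> \<F>" "F \<in> faces"
    using facet_face by blast
  then have "\<Inter>\<F> \<in> faces"
    using faces_down by blast
  then show "primeideal (ideal_sum R \<P> (\<lambda>P. P)) R"
    using \<F> assms(2) by (simp add: ideal_sum_face_primes primeideal_face_prime)
  show "uniformly_F_compatible p R (ideal_sum R \<P> (\<lambda>P. P))"
  proof (rule R.uniformly_F_compatible_ideal_sum)
    fix P assume P: "P \<in> \<P>"
    with assms(1) show "ideal P R"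
      by (intro ideal_minimal_prime) auto
    from P \<F> show "uniformly_F_compatible p R P"
      using uniformly_F_compatible_minimal_prime [OF p_pos] by auto
  qed
qed

text \<open>
  A cycle of inclusions. A uniformly \<open>F\<close>-compatible prime is its own Cartier core, Cartier cores of
  primes are sums of minimal primes, and such sums are uniformly \<open>F\<close>-compatible primes.
\<close>

lemma F_pure_center_points_eq_cartier_cores:
  "F_pure_center_points p R = cartier_core p R ` {Q. primeideal Q R}"
  and cartier_cores_eq_sums:
  "cartier_core p R ` {Q. primeideal Q R} =
     {ideal_sum R \<P> (\<lambda>P. P) | \<P>. \<P> \<subseteq> minimal_primes R \<and> \<P> \<noteq> {}}"
proof -
  let ?sums = "{ideal_sum R \<P> (\<lambda>P. P) | \<P>. \<P> \<subseteq> minimal_primes R \<and> \<P> \<noteq> {}}"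
  have 1: "F_pure_center_points p R \<subseteq> cartier_core p R ` {Q. primeideal Q R}"
  proof
    fix Q assume "Q \<in> F_pure_center_points p R"
    then have Q: "primeideal Q R" "uniformly_F_compatible p R Q"
      by (auto simp: F_pure_center_points_def)
    interpret Q: primeideal Q R by (rule Q)
    have "cartier_core p R Q = Q"
      using cartier_core_prime_subset [OF Q(1)]
        uniformly_F_compatible_subset_cartier_core [OF Q(2) Q.a_subset] by blast
    with Q(1) show "Q \<in> cartier_core p R ` {Q. primeideal Q R}"
      by (metis imageI mem_Collect_eq)
  qed
  have 2: "cartier_core p R ` {Q. primeideal Q R} \<subseteq> ?sums"
  proof clarify
    fix Q assume Q: "primeideal Q R"
    obtain F where "F \<in> facets" "face_prime F \<subseteq> Q"
      using prime_contains_facet_prime [OF Q] .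
    then have "{P \<in> minimal_primes R. P \<subseteq> Q} \<noteq> {}"
      by (auto simp: minimal_primes_eq)
    then show "\<exists>\<P>. cartier_core p R Q = ideal_sum R \<P> (\<lambda>P. P) \<and> \<P> \<subseteq> minimal_primes R \<and> \<P> \<noteq> {}"
      using cartier_core_prime_eq [OF Q] by blast
  qed
  have 3: "?sums \<subseteq> F_pure_center_points p R"
    using sum_of_minimal_primes by (auto simp: F_pure_center_points_def)
  show "F_pure_center_points p R = cartier_core p R ` {Q. primeideal Q R}"
    using 1 2 3 by (meson subset_antisym subset_trans)
  show "cartier_core p R ` {Q. primeideal Q R} = ?sums"
    using 1 2 3 by (meson subset_antisym subset_trans)
qed

end

theorem theoremC:
  fixes V :: "'x set"
    and I :: "('x, 'k::field) mpoly set"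
    and R :: "('x, 'k) mpoly set ring"
    and p :: nat
  assumes "finite V"
    and "squarefree_monomial_ideal V I"
    and "R = mpoly_ring V Quot I"
    and "CHAR('k) = p" and "prime p"
    and "F_finite p (class_ring :: 'k ring)"
  shows
    "(\<forall>Q. primeideal Q R \<longrightarrow>
        cartier_core p R Q = ideal_sum R {P \<in> minimal_primes R. P \<subseteq> Q} (\<lambda>P. P)) \<and>
     cartier_core p R ` {Q. primeideal Q R} = F_pure_center_points p R \<and>
     cartier_core p R ` {Q. primeideal Q R} =
       {ideal_sum R \<P> (\<lambda>P. P) | \<P>. \<P> \<subseteq> minimal_primes R \<and> \<P> \<noteq> {}} \<and>
     (\<forall>J. ideal J R \<longrightarrow>
        cartier_core p R J =
          ideal_sum R {\<Q>. \<Q> \<subseteq> minimal_primes R \<and> carrier R \<inter> \<Inter>\<Q> \<subseteq> J}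
            (\<lambda>\<Q>. carrier R \<inter> \<Inter>\<Q>))"
proof -
  obtain faces where faces: "faces \<subseteq> Pow V" "\<And>A B. A \<in> faces \<Longrightarrow> B \<subseteq> A \<Longrightarrow> B \<in> faces"
    "I = monomial_ideal V faces"
    using squarefree_monomial_ideal_faces [OF assms(2)] by metis
  interpret stanley_reisner_prime_char V faces R p
    by standard (use assms faces in auto)
  show ?thesis
    using cartier_core_eq cartier_core_prime_eq cartier_cores_eq_sums
      F_pure_center_points_eq_cartier_cores by blast
qed

end
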